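(* Let $N\ge 1$ and $l\ge 1$ be integers, let $b=r_1>r_2>\cdots>r_l=a\ge 0$ be the uncertainty radii, and run the Sample Reuse Algorithm with sample size $N$ for a family ${\cal B}(r)$ of uncertainty sets which is either the family of $\ell_p$ balls ${\cal B}_p(r)\subset\mathbf{R}^n$, the family of homogeneous star-shaped bounding sets ${\cal B}_H(r)\subset\mathbf{R}^n$, or the family of spectral norm balls ${\cal B}_\sigma(r)$. Let $\mathbf{n}_i$ be the number of simulations (sampling experiments) that the algorithm performs at $r_i$, and let $$\mathcal{F}_{reuse}:=\frac{Nl}{\mathcal{E}\left[\sum_{i=1}^l \mathbf{n}_i\right]}$$ be the sample reuse factor, where $\mathcal{E}$ denotes expectation. Then $$\mathcal{F}_{reuse}=\frac{l}{\,l-\sum_{i=2}^l\left(\frac{r_i}{r_{i-1}}\right)^d\,},$$ where $d=n$ for the $\ell_p$ ball ${\cal B}_p(r)$ and for the homogeneous star-shaped bounding set ${\cal B}_H(r)$, and $$d=\sum_{i=1}^s\kappa(q_i)+\sum_{j=1}^c\kappa(\Delta_j)$$ for the spectral norm ball ${\cal B}_\sigma(r)$, with $\kappa(X):=2mn$ if $X$ is a variable in $\mathbf{C}^{n\times m}$ and $\kappa(X):=mn$ if $X$ is a variable in $\mathbf{R}^{n\times m}$.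
   Context: Uncertainty sets. ${\cal B}(r)$, $r\ge 0$, denotes one of the following families. (1) $\ell_p$ ball: ${\cal B}_p(r)=\{\Delta\in\mathbf{R}^n:\|\Delta\|_p\le r\}$, with $p\in\{1,2,\ldots,\infty\}$. (2) Spectral norm ball: ${\cal B}_\sigma(r)=\{\Delta\in\mathbf{\Delta}:\bar\sigma(\Delta)\le r\}$, where $\bar\sigma$ is the largest singular value and $\mathbf{\Delta}=\{\mathrm{blockdiag}[q_1I_{r_1},\ldots,q_sI_{r_s},\Delta_1,\ldots,\Delta_c]\}$. Here the $q_i\in\mathbb{F}$ are scalar parameters with multiplicities given by the sizes of the identity blocks (these multiplicities are unrelated to the uncertainty radii), the $\Delta_j\in\mathbb{F}^{n_j\times m_j}$ are full blocks, and $\mathbb{F}$ is $\mathbf{C}$ or $\mathbf{R}$ (the choice may differ between the variables $q_1,\ldots,q_s,\Delta_1,\ldots,\Delta_c$). These variables range independently. A scalar $q_i$ is regarded as a $1\times1$ matrix variable. (3) Homogeneous star-shaped bounding set: ${\cal B}_H(r)=\{r(\Delta-\Delta_0)+\Delta_0:\Delta\in Q\}$, where $Q\subset\mathbf{R}^n$ is a compact set of positive Lebesgue measure, $\Delta_0\in Q$, and $Q$ is star-shaped with respect to $\Delta_0$ (so that ${\cal B}_H(r)\subseteq{\cal B}_H(r')$ for $r\le r'$). Size function: $\ell(X):=\min\{r:X\in{\cal B}(r)\}$. Volume: $\mathrm{vol}(S)=\int_{q\in S}dq$, where $dq=\prod_{r,s}dx_{rs}$ for a real matrix $q=[x_{rs}]$,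 $dq=\prod_{r,s}dx_{rs}\,dy_{rs}$ for a complex matrix $q=[x_{rs}+jy_{rs}]$, and $dq=(\prod_{i=1}^s dq_i)(\prod_{i=1}^c d\Delta_i)$ for $q\in\mathbf{\Delta}$. A random variable is uniform over ${\cal B}(r)$ if it lies in a set $S$ with probability $\mathrm{vol}(S\cap{\cal B}(r))/\mathrm{vol}({\cal B}(r))$; for $r=0$, where ${\cal B}(0)$ is a single point, it is that point. Sample Reuse Algorithm. Input: sample size $N$ and radii $r_1>\cdots>r_l$. A robustness requirement $\mathbf{P}$ (a yes/no property of an uncertainty sample) is given. Initialize counters $m_{i1}=m_{i2}=0$ for $i=1,\ldots,l$. For $i=1,2,\ldots,l$ in this order: while $m_{i1}<N$, generate a new sample $q$, uniform over ${\cal B}(r_i)$ and independent of all previously generated samples, and evaluate $\mathbf{P}$ for $q$; increase $m_{s1}$ by $1$ for every $s$ such that $r_i\ge r_s\ge\ell(q)$; if $\mathbf{P}$ is satisfied for $q$, also increase $m_{s2}$ by $1$ for every such $s$. When $m_{i1}=N$, output the estimate $m_{i2}/N$ for radius $r_i$ and pass to the next $i$. The number $\mathbf{n}_i$ is the number of samples newly generated in the while loop for index $i$. *)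

theory Defs
  imports
    "HOL-Probability.Probability"
    "HOL-Library.While_Combinator"
    "HOL-Library.Extended_Nat"
    "Jordan_Normal_Form.Char_Poly"
    "Jordan_Normal_Form.Schur_Decomposition"
begin

section \<open>Families of uncertainty sets\<close>

text \<open>
  A family of uncertainty sets is a function from radii (only radii \<open>\<ge> 0\<close> matter) to sets of
  samples.
\<close>

subsection \<open>Balls of the \<open>p\<close>-norms\<close>

definition lp_norm :: "enat \<Rightarrow> real ^ 'n \<Rightarrow> real" where
  "lp_norm p x = (case p of
       enat k \<Rightarrow> root k (\<Sum>i\<in>UNIV. \<bar>vec_nth x i\<bar> ^ k)
     | \<infinity> \<Rightarrow> Max (range (\<lambda>i. \<bar>vec_nth x i\<bar>)))"

definition lp_ball :: "enat \<Rightarrow> real \<Rightarrow> (real ^ 'n) set" where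
  "lp_ball p \<rho> = {x. lp_norm p x \<le> \<rho>}"


subsection \<open>Homogeneous star-shaped bounding sets\<close>

definition star_shaped_wrt :: "'a::real_vector set \<Rightarrow> 'a \<Rightarrow> bool" where
  "star_shaped_wrt Q c \<longleftrightarrow> (\<forall>x\<in>Q. closed_segment c x \<subseteq> Q)"

definition homogeneous_family :: "'a::real_vector set \<Rightarrow> 'a \<Rightarrow> real \<Rightarrow> 'a set" where
  "homogeneous_family Q c \<rho> = {\<rho> *\<^sub>R (x - c) + c | x. x \<in> Q}"


subsection \<open>Spectral norm balls of block-diagonal matrices\<close>

text \<open>
  All matrices are complex; a real variable has its entries in the copy of the reals inside
  the complex numbers.
\<close>

datatype scalar_field = Real_Field | Complex_Field

fun scalars :: "scalar_field \<Rightarrow> complex set" where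
  "scalars Real_Field = \<real>"
| "scalars Complex_Field = UNIV"

text \<open>
  A block structure consists of a list of pairs (field, multiplicity) for the repeated scalar
  blocks and a list of triples (field, number of rows, number of columns) for the full blocks.
\<close>

type_synonym scalar_blocks = "(scalar_field \<times> nat) list"
type_synonym full_blocks = "(scalar_field \<times> nat \<times> nat) list"

definition wf_blocks :: "scalar_blocks \<Rightarrow> full_blocks \<Rightarrow> bool" where
  "wf_blocks sb fb \<longleftrightarrow>
     (sb \<noteq> [] \<or> fb \<noteq> []) \<and>
     (\<forall>(F, k)\<in>set sb. 1 \<le> k) \<and>
     (\<forall>(F, n, m)\<in>set fb. 1 \<le> n \<and> 1 \<le> m)"

definition block_diag ::
  "scalar_blocks \<Rightarrow> full_blocks \<Rightarrow> (nat \<Rightarrow> complex) \<times> (nat \<Rightarrow> complex mat) \<Rightarrow> complex mat" where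
  "block_diag sb fb = (\<lambda>(q, D). diag_block_mat
     (map (\<lambda>i. q i \<cdot>\<^sub>m 1\<^sub>m (snd (sb ! i))) [0..<length sb] @ map D [0..<length fb]))"

definition block_set :: "scalar_blocks \<Rightarrow> full_blocks \<Rightarrow> complex mat set" where
  "block_set sb fb = {block_diag sb fb (q, D) | q D.
     (\<forall>i<length sb. q i \<in> scalars (fst (sb ! i))) \<and>
     (\<forall>j<length fb. case fb ! j of (F, n, m) \<Rightarrow>
        D j \<in> carrier_mat n m \<and> (\<forall>a<n. \<forall>b<m. D j $$ (a, b) \<in> scalars F))}"

text \<open>
  For an \<open>n \<times> m\<close> matrix with \<open>m > n\<close> the following set has the additional member \<open>0\<close>
  compared with the convention of \<open>min n m\<close> singular values; its maximum is the same.
\<close>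

definition singular_values :: "complex mat \<Rightarrow> real set" where
  "singular_values A = {sqrt (Re e) | e. eigenvalue (mat_adjoint A * A) e}"

definition largest_singular_value :: "complex mat \<Rightarrow> real" where
  "largest_singular_value A = Max (singular_values A)"

definition spectral_ball :: "scalar_blocks \<Rightarrow> full_blocks \<Rightarrow> real \<Rightarrow> complex mat set" where
  "spectral_ball sb fb \<rho> = {A \<in> block_set sb fb. largest_singular_value A \<le> \<rho>}"

fun variable_dim :: "scalar_field \<Rightarrow> nat \<Rightarrow> nat \<Rightarrow> nat" where
  "variable_dim Complex_Field n m = 2 * m * n"
| "variable_dim Real_Field n m = m * n"

definition block_dim :: "scalar_blocks \<Rightarrow> full_blocks \<Rightarrow> nat" where
  "block_dim sb fb =
     (\<Sum>(F, k)\<leftarrow>sb. variable_dim F 1 1) + (\<Sum>(F, n, m)\<leftarrow>fb. variable_dim F n m)"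


section \<open>Volume\<close>

text \<open>
  The volume on \<open>\<real>\<^sup>n\<close> is \<^term>\<open>lborel\<close>. The volume on block-diagonal matrices is the product
  of the Lebesgue measures of the variables (each scalar variable counted once, whatever its
  multiplicity), transported along the injective map \<^const>\<open>block_diag\<close>.
\<close>

fun scalar_vol :: "scalar_field \<Rightarrow> complex measure" where
  "scalar_vol Real_Field = embed_measure lborel complex_of_real"
| "scalar_vol Complex_Field = lborel"

definition matrix_vol :: "scalar_field \<Rightarrow> nat \<Rightarrow> nat \<Rightarrow> complex mat measure" where
  "matrix_vol F n m =
     embed_measure (\<Pi>\<^sub>M ab\<in>{..<n} \<times> {..<m}. scalar_vol F) (\<lambda>x. mat n m x)"

definition block_vol :: "scalar_blocks \<Rightarrow> full_blocks \<Rightarrow> complex mat measure" where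
  "block_vol sb fb = embed_measure
     ((\<Pi>\<^sub>M i\<in>{..<length sb}. scalar_vol (fst (sb ! i))) \<Otimes>\<^sub>M
      (\<Pi>\<^sub>M j\<in>{..<length fb}. case fb ! j of (F, n, m) \<Rightarrow> matrix_vol F n m))
     (block_diag sb fb)"


section \<open>Uniform samples\<close>

definition uniform_over :: "'a measure \<Rightarrow> (real \<Rightarrow> 'a set) \<Rightarrow> real \<Rightarrow> 'a measure" where
  "uniform_over vol B \<rho> =
     (if \<rho> = 0 then return vol (THE x. x \<in> B 0) else uniform_measure vol (B \<rho>))"

text \<open>
  \<open>X i k \<omega>\<close> is the \<open>k\<close>-th sample (\<open>k = 0, 1, \<dots>\<close>) available to the while loop for
  index \<open>i\<close>: the loop consumes \<open>X i 0, X i 1, \<dots>\<close> in this order, as far as it needs them.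
\<close>

definition uniform_samples ::
  "'w measure \<Rightarrow> 'a measure \<Rightarrow> (real \<Rightarrow> 'a set) \<Rightarrow> nat \<Rightarrow> (nat \<Rightarrow> real) \<Rightarrow>
   (nat \<Rightarrow> nat \<Rightarrow> 'w \<Rightarrow> 'a) \<Rightarrow> bool" where
  "uniform_samples M vol B l r X \<longleftrightarrow>
     prob_space M \<and>
     prob_space.indep_vars M (\<lambda>_. vol) (\<lambda>(i, k). X i k) ({1..l} \<times> UNIV) \<and>
     (\<forall>i\<in>{1..l}. \<forall>k. distr M vol (X i k) = uniform_over vol B (r i))"


section \<open>The sample reuse algorithm\<close>

definition size_fun :: "(real \<Rightarrow> 'a set) \<Rightarrow> 'a \<Rightarrow> real" where
  "size_fun B x = (LEAST \<rho>. 0 \<le> \<rho> \<and> x \<in> B \<rho>)"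

text \<open>
  \<open>total s\<close> and \<open>passed s\<close> are the two counters \<open>m\<^sub>s\<^sub>1\<close> and \<open>m\<^sub>s\<^sub>2\<close>, \<open>drawn i\<close> is the number of
  samples newly generated in the while loop for index \<open>i\<close>, and \<open>estimate i\<close> is the output for
  the \<open>i\<close>-th radius.
\<close>

record run_state =
  total :: "nat \<Rightarrow> nat"
  passed :: "nat \<Rightarrow> nat"
  drawn :: "nat \<Rightarrow> nat"
  estimate :: "nat \<Rightarrow> real"

definition initial_state :: run_state where
  "initial_state = \<lparr>total = (\<lambda>_. 0), passed = (\<lambda>_. 0), drawn = (\<lambda>_. 0), estimate = (\<lambda>_. 0)\<rparr>"

definition process_sample ::
  "(real \<Rightarrow> 'a set) \<Rightarrow> nat \<Rightarrow> (nat \<Rightarrow> real) \<Rightarrow> ('a \<Rightarrow> bool) \<Rightarrow> nat \<Rightarrow> 'a \<Rightarrow> run_state \<Rightarrow> run_state"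
where
  "process_sample B l r P i q st =
     (let S = {s \<in> {1..l}. r i \<ge> r s \<and> r s \<ge> size_fun B q} in
      st\<lparr>total := (\<lambda>s. if s \<in> S then total st s + 1 else total st s),
         passed := (\<lambda>s. if s \<in> S \<and> P q then passed st s + 1 else passed st s),
         drawn := (drawn st)(i := drawn st i + 1)\<rparr>)"

definition run_index ::
  "(real \<Rightarrow> 'a set) \<Rightarrow> nat \<Rightarrow> nat \<Rightarrow> (nat \<Rightarrow> real) \<Rightarrow> ('a \<Rightarrow> bool) \<Rightarrow> (nat \<Rightarrow> nat \<Rightarrow> 'a) \<Rightarrow>
   nat \<Rightarrow> run_state \<Rightarrow> run_state" where
  "run_index B N l r P x i st =
     (let st' = while (\<lambda>t. total t i < N)
                      (\<lambda>t. process_sample B l r P i (x i (drawn t i)) t) st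
      in st'\<lparr>estimate := (estimate st')(i := real (passed st' i) / real N)\<rparr>)"

definition run_algorithm ::
  "(real \<Rightarrow> 'a set) \<Rightarrow> nat \<Rightarrow> nat \<Rightarrow> (nat \<Rightarrow> real) \<Rightarrow> ('a \<Rightarrow> bool) \<Rightarrow> (nat \<Rightarrow> nat \<Rightarrow> 'a) \<Rightarrow> run_state"
where
  "run_algorithm B N l r P x = fold (run_index B N l r P x) [1..<l + 1] initial_state"

definition num_simulations ::
  "(real \<Rightarrow> 'a set) \<Rightarrow> nat \<Rightarrow> nat \<Rightarrow> (nat \<Rightarrow> real) \<Rightarrow> ('a \<Rightarrow> bool) \<Rightarrow>
   (nat \<Rightarrow> nat \<Rightarrow> 'w \<Rightarrow> 'a) \<Rightarrow> nat \<Rightarrow> 'w \<Rightarrow> nat" where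
  "num_simulations B N l r P X i \<omega> = drawn (run_algorithm B N l r P (\<lambda>i k. X i k \<omega>)) i"

definition reuse_factor ::
  "'w measure \<Rightarrow> (real \<Rightarrow> 'a set) \<Rightarrow> nat \<Rightarrow> nat \<Rightarrow> (nat \<Rightarrow> real) \<Rightarrow> ('a \<Rightarrow> bool) \<Rightarrow>
   (nat \<Rightarrow> nat \<Rightarrow> 'w \<Rightarrow> 'a) \<Rightarrow> real" where
  "reuse_factor M B N l r P X =
     real (N * l) / (\<integral>\<omega>. real (\<Sum>i=1..l. num_simulations B N l r P X i \<omega>) \<partial>M)"

end

theory Submission
  imports Defs
begin

text \<open>
  The identity rests on two facts: the volume of \<open>B(\<rho>)\<close> is \<open>\<rho>\<^sup>d\<close> times the volume of \<open>B(1)\<close>, and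
  the number of fresh samples at a radius is decided before any of them is drawn.

  Almost surely every sample drawn at \<open>r\<^sub>i\<close> lies in \<open>B(r\<^sub>i)\<close>, so each pass of the while loop for \<open>i\<close>
  raises the counter of \<open>i\<close> by one. Hence \<open>n\<^sub>i\<close> is \<open>N\<close> minus the value of that counter when the loop
  starts, and the counter equals the sum over \<open>j < i\<close> of the number of those among the \<open>n\<^sub>j\<close> samples
  drawn at \<open>r\<^sub>j\<close> which lie in \<open>B(r\<^sub>i)\<close>. As \<open>n\<^sub>j\<close> is a function of the rounds before \<open>j\<close>, the event
  \<open>k < n\<^sub>j\<close> is independent of the \<open>k\<close>-th sample of round \<open>j\<close>, and Wald's argument gives
  \<open>E[n\<^sub>i] = N - (\<Sum>j<i. E[n\<^sub>j] (r\<^sub>i / r\<^sub>j)\<^sup>d)\<close> (lemma \<open>expectation_needed_recurrence\<close>).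
  Replacing \<open>r\<^sub>i\<close> by \<open>r\<^sub>i\<^sub>+\<^sub>1\<close> multiplies each summand by the same factor \<open>(r\<^sub>i\<^sub>+\<^sub>1 / r\<^sub>i)\<^sup>d\<close>, and the sum
  for \<open>i\<close> together with \<open>E[n\<^sub>i]\<close> is \<open>N\<close>. The recurrence therefore collapses to
  \<open>E[n\<^sub>i\<^sub>+\<^sub>1] = N (1 - (r\<^sub>i\<^sub>+\<^sub>1 / r\<^sub>i)\<^sup>d)\<close>, and summation over \<open>i\<close> gives the reuse factor.

  A sample outside its own set may make a loop run forever. This happens on a null set only, but the
  Bochner integral in the reuse factor is the expectation only if the number of simulations is a
  measurable function on the whole probability space; this is the content of the second section.

  The probabilistic part is carried out in the locale \<open>scaling_family\<close>, and each of the three families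
  is an instance. For the homogeneous families the volume law is the behaviour of Lebesgue measure under
  affine maps, and the balls of a \<open>p\<close>-norm are the homogeneous family of the unit ball with centre \<open>0\<close>.
  For the spectral norm, the volume law is inherited by embedded measures and by products of measures
  from the Lebesgue measure of each variable. The singular values enter through the trace of \<open>A\<^sup>* A\<close>:
  the squared Frobenius norm is the sum of the eigenvalues of \<open>A\<^sup>* A\<close>, which are nonnegative, so the
  spectral norm is comparable with the entries. Thus the unit ball has positive and finite volume. It is
  measurable because the condition on the eigenvalues can be tested at rational points.
\<close>

section \<open>Runs of the algorithm on fixed samples\<close>

definition state_before ::
  "(real \<Rightarrow> 'a set) \<Rightarrow> nat \<Rightarrow> nat \<Rightarrow> (nat \<Rightarrow> real) \<Rightarrow> ('a \<Rightarrow> bool) \<Rightarrow> (nat \<Rightarrow> nat \<Rightarrow> 'a) \<Rightarrow> nat \<Rightarrow> run_state"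
where
  "state_before B N l r P x i = fold (run_index B N l r P x) [1..<i] initial_state"

lemma state_before_1 [simp]: "state_before B N l r P x (Suc 0) = initial_state"
  by (simp add: state_before_def)

lemma state_before_Suc:
  "1 \<le> i \<Longrightarrow> state_before B N l r P x (Suc i) = run_index B N l r P x i (state_before B N l r P x i)"
  by (simp add: state_before_def)

text \<open>
  The number of fresh samples that the loop for \<open>i\<close> draws if each of them is counted for \<open>i\<close>. In contrast
  to the true number of draws, it is on every run a function of the samples of the rounds before \<open>i\<close>; the
  independence argument depends on this.
\<close>

definition required ::
  "(real \<Rightarrow> 'a set) \<Rightarrow> nat \<Rightarrow> nat \<Rightarrow> (nat \<Rightarrow> real) \<Rightarrow> ('a \<Rightarrow> bool) \<Rightarrow> (nat \<Rightarrow> nat \<Rightarrow> 'a) \<Rightarrow> nat \<Rightarrow> nat"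
where
  "required B N l r P x i = N - total (state_before B N l r P x i) i"

lemma total_process_sample:
  "total (process_sample B l r P i q st) s =
     (if s \<in> {1..l} \<and> r s \<le> r i \<and> size_fun B q \<le> r s then total st s + 1 else total st s)"
  by (simp add: process_sample_def Let_def)

lemma drawn_process_sample:
  "drawn (process_sample B l r P i q st) = (drawn st)(i := drawn st i + 1)"
  by (simp add: process_sample_def Let_def)

lemma while_eq_iterate:
  "while b c s = (if \<exists>k. \<not> b ((c ^^ k) s) then (c ^^ (LEAST k. \<not> b ((c ^^ k) s))) s else the None)"
  by (simp add: while_def while_option_def)

lemma run_index_good_samples:
  fixes x :: "nat \<Rightarrow> nat \<Rightarrow> 'a"
  assumes i: "i \<in> {1..l}" and good: "\<And>k. size_fun B (x i k) \<le> r i"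
    and fresh: "drawn st i = 0" and le: "total st i \<le> N"
  shows "total (run_index B N l r P x i st) s = total st s +
      (\<Sum>k<N - total st i. of_bool (s \<in> {1..l} \<and> r s \<le> r i \<and> size_fun B (x i k) \<le> r s))"
    and "drawn (run_index B N l r P x i st) = (drawn st)(i := N - total st i)"
proof -
  define c where "c = (\<lambda>t. process_sample B l r P i (x i (drawn t i)) t)"
  \<comment> \<open>Iterating the body \<open>k\<close> times consumes the samples \<open>0, \<dots>, k - 1\<close>, whatever the guard says; the
    guard only determines how many iterations take place.\<close>
  define hit where "hit = (\<lambda>s k. s \<in> {1..l} \<and> r s \<le> r i \<and> size_fun B (x i k) \<le> r s)"
  have it: "drawn ((c ^^ k) st) = (drawn st)(i := k) \<and>
      (\<forall>s. total ((c ^^ k) st) s = total st s + (\<Sum>k'<k. of_bool (hit s k')))" for k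
  proof (induction k)
    case 0
    then show ?case using fresh by auto
  next
    case (Suc k)
    have "(c ^^ Suc k) st = process_sample B l r P i (x i k) ((c ^^ k) st)"
      using Suc by (simp add: c_def)
    then show ?case
      using Suc by (auto simp: total_process_sample drawn_process_sample hit_def fun_eq_iff)
  qed
  have own: "total ((c ^^ k) st) i = total st i + k" for k
    using it[of k] i good by (simp add: hit_def)
  have "(LEAST k. \<not> total ((c ^^ k) st) i < N) = N - total st i"
    unfolding own by (rule Least_equality) (use le in auto)
  moreover have "\<exists>k. \<not> total ((c ^^ k) st) i < N"
    unfolding own by (rule exI[of _ N]) simp
  ultimately have "while (\<lambda>t. total t i < N) c st = (c ^^ (N - total st i)) st"
    by (simp add: while_eq_iterate)
  then have run: "total (run_index B N l r P x i st) = total ((c ^^ (N - total st i)) st)"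
    "drawn (run_index B N l r P x i st) = drawn ((c ^^ (N - total st i)) st)"
    by (simp_all add: run_index_def Let_def c_def)
  show "total (run_index B N l r P x i st) s = total st s +
      (\<Sum>k<N - total st i. of_bool (s \<in> {1..l} \<and> r s \<le> r i \<and> size_fun B (x i k) \<le> r s))"
    using it[of "N - total st i"] by (simp add: run hit_def)
  show "drawn (run_index B N l r P x i st) = (drawn st)(i := N - total st i)"
    using it[of "N - total st i"] by (simp add: run)
qed

text \<open>
  The counter of a radius index never exceeds \<open>N\<close> before its loop: a sample counted for \<open>s > i\<close> in one of
  the rounds up to \<open>i\<close> is also counted for \<open>i\<close>, and the counter of \<open>i\<close> is exactly \<open>N\<close> when the loop for \<open>i\<close>
  ends. This bound is proved together with the formula for the counters, because it turns the truncated
  subtraction in \<^const>\<open>required\<close> into a true one.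
\<close>

lemma state_before_good_samples:
  fixes x :: "nat \<Rightarrow> nat \<Rightarrow> 'a"
  assumes decr: "\<And>i j. 1 \<le> i \<Longrightarrow> i \<le> j \<Longrightarrow> j \<le> l \<Longrightarrow> r j \<le> r i"
    and good: "\<And>i k. i \<in> {1..l} \<Longrightarrow> size_fun B (x i k) \<le> r i"
    and i: "1 \<le> i" "i \<le> Suc l"
  shows "(\<forall>s\<in>{i..l}. total (state_before B N l r P x i) s =
            (\<Sum>j=1..<i. \<Sum>k<required B N l r P x j. of_bool (size_fun B (x j k) \<le> r s))) \<and>
         (\<forall>s\<in>{i..l}. total (state_before B N l r P x i) s \<le> N) \<and>
         (\<forall>j. drawn (state_before B N l r P x i) j =
            (if j \<in> {1..<i} then required B N l r P x j else 0))"
  using i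
proof (induction i rule: nat_induct_at_least)
  case base
  then show ?case by (simp add: initial_state_def)
next
  case (Suc i)
  let ?st = "state_before B N l r P x i"
  have i: "i \<in> {1..l}" using Suc by auto
  note IH = Suc.IH[OF Suc_leD[OF Suc.prems]]
  have IH1: "total ?st s = (\<Sum>j=1..<i. \<Sum>k<required B N l r P x j. of_bool (size_fun B (x j k) \<le> r s))"
    if "s \<in> {i..l}" for s using IH that by blast
  have IH2: "total ?st s \<le> N" if "s \<in> {i..l}" for s using IH that by blast
  have IH3: "drawn ?st j = (if j \<in> {1..<i} then required B N l r P x j else 0)" for j
    using IH by blast
  have step: "state_before B N l r P x (Suc i) = run_index B N l r P x i ?st"
    using Suc.hyps by (rule state_before_Suc)
  have req: "required B N l r P x i = N - total ?st i"
    by (simp add: required_def)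
  have tot: "total (state_before B N l r P x (Suc i)) s = total ?st s +
      (\<Sum>k<required B N l r P x i. of_bool (size_fun B (x i k) \<le> r s))" if s: "s \<in> {i..l}" for s
  proof -
    have "s \<in> {1..l}" "r s \<le> r i" using s i decr[of i s] by auto
    then show ?thesis
      unfolding step req
      using run_index_good_samples(1)[where s = s and x = x and B = B and r = r and st = ?st
          and N = N and P = P, OF i good[OF i] _ IH2] i
      by (simp add: IH3)
  qed
  have drawn: "drawn (state_before B N l r P x (Suc i)) = (drawn ?st)(i := required B N l r P x i)"
    unfolding step req
    using run_index_good_samples(2)[where x = x and B = B and r = r and st = ?st
        and N = N and P = P, OF i good[OF i] _ IH2] i
    by (simp add: IH3)
  have split: "{1..<Suc i} = insert i {1..<i}" using i by auto
  have *: "total (state_before B N l r P x (Suc i)) s =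
     (\<Sum>j=1..<Suc i. \<Sum>k<required B N l r P x j. of_bool (size_fun B (x j k) \<le> r s))"
    if "s \<in> {i..l}" for s
    using tot[OF that] IH1[OF that] i by (simp add: split)
  have "total (state_before B N l r P x (Suc i)) i = N"
    using tot[of i] good[OF i] i IH2[of i] by (simp add: req)
  moreover have "total (state_before B N l r P x (Suc i)) s \<le> total (state_before B N l r P x (Suc i)) i"
    if s: "s \<in> {Suc i..l}" for s
  proof -
    have "r s \<le> r i" using s i decr[of i s] by auto
    moreover have "s \<in> {i..l}" "i \<in> {i..l}" using s i by auto
    ultimately show ?thesis
      unfolding *[OF \<open>s \<in> {i..l}\<close>] *[OF \<open>i \<in> {i..l}\<close>]
      by (intro sum_mono) (auto simp: of_bool_def)
  qed
  moreover have "\<forall>j. drawn (state_before B N l r P x (Suc i)) j =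
     (if j \<in> {1..<Suc i} then required B N l r P x j else 0)"
    using IH3 i by (auto simp: drawn)
  ultimately show ?case
    using * by auto
qed

section \<open>Measurability of the run\<close>

text \<open>
  Only the components that determine the number of draws are considered. The component \<^const>\<open>passed\<close>
  depends on an arbitrary predicate \<open>P\<close> and may fail to be measurable.
\<close>

definition measurable_state :: "'w measure \<Rightarrow> ('w \<Rightarrow> run_state) \<Rightarrow> bool" where
  "measurable_state M st \<longleftrightarrow>
     (\<forall>s. (\<lambda>\<omega>. total (st \<omega>) s) \<in> measurable M (count_space UNIV)) \<and>
     (\<forall>s. (\<lambda>\<omega>. drawn (st \<omega>) s) \<in> measurable M (count_space UNIV))"

lemma measurable_stateD:
  assumes "measurable_state M st"
  shows "(\<lambda>\<omega>. total (st \<omega>) s) \<in> measurable M (count_space UNIV)"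
    "(\<lambda>\<omega>. drawn (st \<omega>) s) \<in> measurable M (count_space UNIV)"
  using assms by (auto simp: measurable_state_def)

lemma measurable_state_const: "measurable_state M (\<lambda>_. st)"
  by (simp add: measurable_state_def)

text \<open>
  The number of iterations of a loop is itself random. As it is a natural number, the state after the loop
  is pieced together from countably many measurable states.
\<close>

lemma measurable_state_countable_choice:
  fixes n :: "'w \<Rightarrow> nat"
  assumes "\<And>k. measurable_state M (st k)" "n \<in> measurable M (count_space UNIV)"
  shows "measurable_state M (\<lambda>\<omega>. st (n \<omega>) \<omega>)"
  using assms by (auto simp: measurable_state_def intro: measurable_compose_countable)

lemma measurable_state_If:
  assumes "Measurable.pred M Q" "measurable_state M st" "measurable_state M st'"
  shows "measurable_state M (\<lambda>\<omega>. if Q \<omega> then st \<omega> else st' \<omega>)"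
  using assms
  by (auto simp: measurable_state_def if_distrib[of total] if_distrib[of drawn] if_distribR
      intro!: measurable_If)

lemma measurable_state_process_sample:
  assumes st: "measurable_state M st"
    and Z: "\<And>s. s \<in> {1..l} \<Longrightarrow> Measurable.pred M (\<lambda>\<omega>. size_fun B (Z \<omega>) \<le> r s)"
  shows "measurable_state M (\<lambda>\<omega>. process_sample B l r P i (Z \<omega>) (st \<omega>))"
proof -
  note [measurable] = measurable_stateD[OF st] Z
  have "(\<lambda>\<omega>. total (process_sample B l r P i (Z \<omega>) (st \<omega>)) s) \<in> measurable M (count_space UNIV)" for s
    by (cases "s \<in> {1..l}") (simp_all add: total_process_sample)
  moreover have "(\<lambda>\<omega>. drawn (process_sample B l r P i (Z \<omega>) (st \<omega>)) s) \<in> measurable M (count_space UNIV)" for s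
    by (simp add: drawn_process_sample)
  ultimately show ?thesis
    by (simp add: measurable_state_def)
qed

text \<open>
  The final state of a terminating loop is the iterate at the first time the guard fails, and that time is a
  measurable function. Where the loop does not terminate, its value is the constant \<open>the None\<close>, so
  measurability holds there as well.
\<close>

lemma measurable_state_run_index:
  assumes st: "measurable_state M st"
    and Z: "\<And>s k. s \<in> {1..l} \<Longrightarrow> Measurable.pred M (\<lambda>\<omega>. size_fun B (x \<omega> i k) \<le> r s)"
  shows "measurable_state M (\<lambda>\<omega>. run_index B N l r P (x \<omega>) i (st \<omega>))"
proof -
  define c where "c = (\<lambda>\<omega> t. process_sample B l r P i (x \<omega> i (drawn t i)) t)"
  have it: "measurable_state M (\<lambda>\<omega>. (c \<omega> ^^ k) (st \<omega>))" for k
  proof (induction k)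
    case 0
    then show ?case using st by simp
  next
    case (Suc k)
    then show ?case
      unfolding c_def funpow.simps comp_def
      by (intro measurable_state_process_sample)
        (auto intro!: measurable_compose_countable[OF Z] measurable_stateD)
  qed
  have [measurable]: "Measurable.pred M (\<lambda>\<omega>. \<not> total ((c \<omega> ^^ k) (st \<omega>)) i < N)" for k
    using measurable_stateD(1)[OF it[of k], measurable] by measurable
  have "(\<lambda>\<omega>. LEAST k. \<not> total ((c \<omega> ^^ k) (st \<omega>)) i < N) \<in> measurable M (count_space UNIV)"
    by measurable
  with it have "measurable_state M (\<lambda>\<omega>. (c \<omega> ^^ (LEAST k. \<not> total ((c \<omega> ^^ k) (st \<omega>)) i < N)) (st \<omega>))"
    by (rule measurable_state_countable_choice)
  then have "measurable_state M (\<lambda>\<omega>. while (\<lambda>t. total t i < N) (c \<omega>) (st \<omega>))"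
    unfolding while_eq_iterate
    by (intro measurable_state_If measurable_state_const) measurable
  then show ?thesis
    by (simp add: run_index_def Let_def c_def measurable_state_def)
qed

lemma measurable_state_before:
  assumes Z: "\<And>s j k. s \<in> {1..l} \<Longrightarrow> j \<in> {1..<i} \<Longrightarrow> Measurable.pred M (\<lambda>\<omega>. size_fun B (x \<omega> j k) \<le> r s)"
    and "1 \<le> i"
  shows "measurable_state M (\<lambda>\<omega>. state_before B N l r P (x \<omega>) i)"
  using assms(2,1)
proof (induction i rule: nat_induct_at_least)
  case base
  then show ?case by (simp add: measurable_state_const)
next
  case (Suc i)
  then show ?case
    by (auto simp: state_before_Suc intro!: measurable_state_run_index)
qed

lemma run_algorithm_eq: "run_algorithm B N l r P x = state_before B N l r P x (Suc l)"
  by (simp add: run_algorithm_def state_before_def)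

section \<open>Uniform samples of a scaling family\<close>

text \<open>
  What the analysis of the algorithm uses about a family of uncertainty sets. The assumption
  \<open>least_radius\<close> says that the minimum in the definition of the size function is attained and that
  membership in \<open>B \<sigma>\<close> is equivalent to having size at most \<open>\<sigma>\<close>. The volume law is assumed for positive
  radii; at radius \<open>0\<close> it follows because \<open>B 0\<close> is contained in sets of arbitrarily small volume.
\<close>

locale scaling_family =
  fixes vol :: "'a measure" and B :: "real \<Rightarrow> 'a set" and d :: nat and K :: real
  assumes dim_pos: "1 \<le> d" and unit_vol_pos: "0 < K"
    and sets_B: "0 \<le> \<rho> \<Longrightarrow> B \<rho> \<in> sets vol"
    and emeasure_B_pos: "0 < \<rho> \<Longrightarrow> emeasure vol (B \<rho>) = ennreal (\<rho> ^ d * K)"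
    and B_mono: "0 \<le> \<rho> \<Longrightarrow> \<rho> \<le> \<rho>' \<Longrightarrow> B \<rho> \<subseteq> B \<rho>'"
    and least_radius: "0 \<le> \<rho> \<Longrightarrow> x \<in> B \<rho> \<Longrightarrow> \<exists>m\<ge>0. \<forall>\<sigma>\<ge>0. x \<in> B \<sigma> \<longleftrightarrow> m \<le> \<sigma>"
    and B_0: "\<exists>c. B 0 = {c}"
begin

lemma size_fun_le_iff:
  assumes "0 \<le> \<rho>" "x \<in> B \<rho>" "0 \<le> \<sigma>"
  shows "size_fun B x \<le> \<sigma> \<longleftrightarrow> x \<in> B \<sigma>"
proof -
  obtain m where m: "m \<ge> 0" "\<And>\<sigma>. \<sigma> \<ge> 0 \<Longrightarrow> x \<in> B \<sigma> \<longleftrightarrow> m \<le> \<sigma>"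
    using least_radius[OF assms(1,2)] by blast
  have "size_fun B x = m"
    unfolding size_fun_def using m by (intro Least_equality) auto
  then show ?thesis using m assms by simp
qed

text \<open>
  A point that belongs to no set of the family has no size, and \<^const>\<open>size_fun\<close> assigns to all such points
  the same unspecified real number. The sublevel sets therefore remain measurable: they contain either all
  of these points or none.
\<close>

lemma sets_size_fun_le:
  assumes "0 \<le> \<sigma>"
  shows "{x \<in> space vol. size_fun B x \<le> \<sigma>} \<in> sets vol"
proof -
  define U where "U = (\<Union>n. B (real n))"
  have U: "U \<in> sets vol" unfolding U_def using sets_B by auto
  have sub: "B \<rho> \<subseteq> U" if "0 \<le> \<rho>" for \<rho>
    using B_mono[OF that, of "real (nat \<lceil>\<rho>\<rceil>)"] real_nat_ceiling_ge[of \<rho>] unfolding U_def by blast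
  have in_U: "size_fun B x \<le> \<sigma> \<longleftrightarrow> x \<in> B \<sigma>" if x: "x \<in> U" for x
  proof -
    obtain n where "x \<in> B (real n)" using x unfolding U_def by blast
    then show ?thesis using assms by (intro size_fun_le_iff) auto
  qed
  have not_U: "size_fun B x = (LEAST \<rho>. False)" if "x \<notin> U" for x
  proof -
    have "(\<lambda>\<rho>. 0 \<le> \<rho> \<and> x \<in> B \<rho>) = (\<lambda>_. False)" using sub that by blast
    then show ?thesis unfolding size_fun_def by simp
  qed
  have "{x \<in> space vol. size_fun B x \<le> \<sigma>} =
      B \<sigma> \<union> (if (LEAST \<rho>::real. False) \<le> \<sigma> then space vol - U else {})"
  proof (rule Set.set_eqI)
    fix x
    show "x \<in> {x \<in> space vol. size_fun B x \<le> \<sigma>} \<longleftrightarrow>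
        x \<in> B \<sigma> \<union> (if (LEAST \<rho>::real. False) \<le> \<sigma> then space vol - U else {})"
      using in_U[of x] not_U[of x] sub[OF assms] sets.sets_into_space[OF sets_B[OF assms]]
        sets.sets_into_space[OF U] by (cases "x \<in> U") auto
  qed
  then show ?thesis using sets_B[OF assms] U by auto
qed

lemma emeasure_B:
  assumes "0 \<le> \<rho>"
  shows "emeasure vol (B \<rho>) = ennreal (\<rho> ^ d * K)"
proof (cases "\<rho> = 0")
  case True
  have small: "emeasure vol (B 0) \<le> ennreal e" if e: "0 < e" for e
  proof -
    \<comment> \<open>A radius at most \<open>1\<close> satisfies \<open>\<sigma>\<^sup>d \<le> \<sigma>\<close>, since \<open>d \<ge> 1\<close>.\<close>
    define \<sigma> where "\<sigma> = min 1 (e / K)"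
    have \<sigma>: "0 < \<sigma>" "\<sigma> \<le> 1" "\<sigma> * K \<le> e"
      using e unit_vol_pos by (auto simp: \<sigma>_def min_def field_simps)
    have "\<sigma> ^ d \<le> \<sigma> ^ 1"
      using \<sigma> dim_pos by (intro power_decreasing) auto
    then have "\<sigma> ^ d * K \<le> \<sigma> * K"
      using unit_vol_pos by (intro mult_right_mono) auto
    with \<sigma>(3) have le_e: "\<sigma> ^ d * K \<le> e" by linarith
    have "emeasure vol (B 0) \<le> emeasure vol (B \<sigma>)"
      using \<sigma> by (intro emeasure_mono B_mono sets_B) auto
    also have "\<dots> = ennreal (\<sigma> ^ d * K)" using \<sigma> by (intro emeasure_B_pos)
    also have "\<dots> \<le> ennreal e" using le_e by (rule ennreal_leI)
    finally show ?thesis .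
  qed
  have "emeasure vol (B 0) \<le> 0"
    by (rule ennreal_le_epsilon) (simp add: small)
  then show ?thesis using True dim_pos by (simp add: power_0_left)
qed (use assms emeasure_B_pos in auto)

lemma measure_uniform_over:
  assumes "0 < \<rho>" "0 \<le> \<sigma>" "\<sigma> \<le> \<rho>"
  shows "measure (uniform_over vol B \<rho>) (B \<sigma>) = (\<sigma> / \<rho>) ^ d"
proof -
  have m: "measure vol (B \<tau>) = \<tau> ^ d * K" if "0 \<le> \<tau>" for \<tau>
    using emeasure_B[OF that] unit_vol_pos that by (intro measure_eq_emeasure_eq_ennreal) auto
  have "emeasure vol (B \<rho>) \<noteq> 0" "emeasure vol (B \<rho>) \<noteq> \<infinity>"
    using emeasure_B[of \<rho>] assms unit_vol_pos by (auto simp: ennreal_eq_0_iff not_le)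
  moreover have "B \<rho> \<inter> B \<sigma> = B \<sigma>" using B_mono[of \<sigma> \<rho>] assms by auto
  ultimately show ?thesis
    using assms unit_vol_pos sets_B[of \<sigma>]
    by (simp add: uniform_over_def m power_divide)
qed

lemma measure_uniform_over_self:
  assumes "0 \<le> \<rho>"
  shows "measure (uniform_over vol B \<rho>) (B \<rho>) = 1"
proof (cases "\<rho> = 0")
  case True
  obtain c where c: "B 0 = {c}" using B_0 by blast
  then show ?thesis using True sets_B[of 0]
    by (simp add: uniform_over_def measure_return)
qed (use measure_uniform_over[of \<rho> \<rho>] assms in simp)

end

section \<open>Expected number of simulations\<close>

lemma state_before_cong:
  assumes "1 \<le> i" "\<And>j. 1 \<le> j \<Longrightarrow> j < i \<Longrightarrow> x j = y j"
  shows "state_before B N l r P x i = state_before B N l r P y i"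
  using assms
proof (induction i rule: nat_induct_at_least)
  case (Suc i)
  then show ?case by (simp add: state_before_Suc run_index_def)
qed simp

locale sample_reuse_run = scaling_family vol B d K
  for vol :: "'a measure" and B :: "real \<Rightarrow> 'a set" and d :: nat and K :: real +
  fixes M :: "'w measure" and N l :: nat and r :: "nat \<Rightarrow> real" and P :: "'a \<Rightarrow> bool"
    and X :: "nat \<Rightarrow> nat \<Rightarrow> 'w \<Rightarrow> 'a"
  assumes N_pos: "1 \<le> N" and l_pos: "1 \<le> l"
    and r_decreasing: "\<forall>i\<in>{1..<l}. r (i + 1) < r i" and r_last: "0 \<le> r l"
    and samples: "uniform_samples M vol B l r X"
begin

sublocale prob_space M
  using samples by (simp add: uniform_samples_def)

lemma r_strict_antimono:
  assumes "1 \<le> i" "i < j" "j \<le> l" shows "r j < r i"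
  using assms(2,3)
proof (induction j)
  case (Suc j)
  have "r (Suc j) < r j" using r_decreasing Suc.prems assms(1) by simp
  then show ?case using Suc by (cases "i = j") auto
qed simp

lemma r_antimono: "1 \<le> i \<Longrightarrow> i \<le> j \<Longrightarrow> j \<le> l \<Longrightarrow> r j \<le> r i"
  using r_strict_antimono[of i j] by (cases "i = j") auto

lemma r_nonneg: "1 \<le> i \<Longrightarrow> i \<le> l \<Longrightarrow> 0 \<le> r i"
  using r_antimono[of i l] r_last by simp

lemma r_pos: "1 \<le> i \<Longrightarrow> i < l \<Longrightarrow> 0 < r i"
  using r_strict_antimono[of i l] r_last by simp

lemma measurable_X: "i \<in> {1..l} \<Longrightarrow> X i k \<in> measurable M vol"
  using samples by (auto simp: uniform_samples_def indep_vars_def)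

lemma pred_size_fun_X:
  assumes "s \<in> {1..l}" "Z \<in> measurable M' vol"
  shows "Measurable.pred M' (\<lambda>\<omega>. size_fun B (Z \<omega>) \<le> r s)"
  using sets_size_fun_le[OF r_nonneg] assms measurable_compose[of Z M' vol "\<lambda>x. size_fun B x \<le> r s"]
  by (auto simp: pred_def)

lemma prob_X:
  assumes "j \<in> {1..l}" "A \<in> sets vol"
  shows "prob {\<omega> \<in> space M. X j k \<omega> \<in> A} = measure (uniform_over vol B (r j)) A"
proof -
  have "measure (distr M vol (X j k)) A = prob (X j k -` A \<inter> space M)"
    using assms measurable_X by (intro measure_distr) auto
  moreover have "X j k -` A \<inter> space M = {\<omega> \<in> space M. X j k \<omega> \<in> A}" by auto
  ultimately show ?thesis using samples assms by (simp add: uniform_samples_def)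
qed

lemma AE_good_samples: "AE \<omega> in M. \<forall>i\<in>{1..l}. \<forall>k. X i k \<omega> \<in> B (r i)"
proof -
  have "AE \<omega> in M. X i k \<omega> \<in> B (r i)" if i: "i \<in> {1..l}" for i k
  proof (rule AE_prob_1[THEN AE_mp])
    show "prob {\<omega> \<in> space M. X i k \<omega> \<in> B (r i)} = 1"
      using i sets_B r_nonneg by (subst prob_X) (auto intro: measure_uniform_over_self)
  qed auto
  then show ?thesis by (simp add: AE_ball_countable AE_all_countable)
qed

definition needed :: "nat \<Rightarrow> 'w \<Rightarrow> nat" where
  "needed i \<omega> = required B N l r P (\<lambda>j k. X j k \<omega>) i"

lemma needed_le: "needed i \<omega> \<le> N"
  by (simp add: needed_def required_def)

lemma measurable_required:
  assumes "i \<in> {1..l}" and "\<And>j k. j \<in> {1..<i} \<Longrightarrow> (\<lambda>\<omega>. x \<omega> j k) \<in> measurable M' vol"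
  shows "(\<lambda>\<omega>. required B N l r P (x \<omega>) i) \<in> measurable M' (count_space UNIV)"
proof -
  have "measurable_state M' (\<lambda>\<omega>. state_before B N l r P (x \<omega>) i)"
    using assms by (intro measurable_state_before pred_size_fun_X) auto
  from measurable_stateD(1)[OF this] show ?thesis
    unfolding required_def by measurable
qed

lemma measurable_needed: "i \<in> {1..l} \<Longrightarrow> needed i \<in> measurable M (count_space UNIV)"
  unfolding needed_def by (intro measurable_required measurable_X) auto

text \<open>
  The number \<open>needed j\<close> is computed from the samples of the rounds before \<open>j\<close>, a block of coordinates
  disjoint from the single coordinate \<open>(j, k)\<close>.
\<close>

lemma prob_needed_and_sample:
  assumes j: "j \<in> {1..l}" and A: "A \<in> sets vol"
  shows "prob {\<omega> \<in> space M. k < needed j \<omega> \<and> X j k \<omega> \<in> A} =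
    prob {\<omega> \<in> space M. k < needed j \<omega>} * prob {\<omega> \<in> space M. X j k \<omega> \<in> A}"
proof -
  let ?J = "{1..<j} \<times> (UNIV :: nat set)" and ?J' = "{(j, k)}"
  let ?X = "\<lambda>p \<omega>. (case p of (i, k) \<Rightarrow> X i k) \<omega>"
  have "indep_vars (\<lambda>_. vol) (\<lambda>(i, k). X i k) ({1..l} \<times> UNIV)"
    using samples by (simp add: uniform_samples_def)
  then have iv: "indep_var (PiM ?J (\<lambda>_. vol)) (\<lambda>\<omega>. restrict (\<lambda>p. ?X p \<omega>) ?J)
      (PiM ?J' (\<lambda>_. vol)) (\<lambda>\<omega>. restrict (\<lambda>p. ?X p \<omega>) ?J')"
    using j by (intro indep_var_restrict) auto
  define f where "f = (\<lambda>y :: nat \<times> nat \<Rightarrow> 'a. required B N l r P (\<lambda>a b. y (a, b)) j)"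
  have f: "f \<in> measurable (PiM ?J (\<lambda>_. vol)) (count_space UNIV)"
    unfolding f_def using j by (intro measurable_required measurable_component_singleton) auto
  \<comment> \<open>The constant \<open>indep_var\<close> requires values of one type, so the sample is replaced by the indicator of
    the event in question, a natural number like \<open>needed j\<close>.\<close>
  define g where "g = (\<lambda>y :: nat \<times> nat \<Rightarrow> 'a. of_bool (y (j, k) \<in> A) :: nat)"
  have [measurable]: "(\<lambda>y. y (j, k)) \<in> measurable (PiM ?J' (\<lambda>_. vol)) vol"
    by (intro measurable_component_singleton) auto
  have g: "g \<in> measurable (PiM ?J' (\<lambda>_. vol)) (count_space UNIV)"
    unfolding g_def of_bool_def using A by measurable
  have "f \<circ> (\<lambda>\<omega>. restrict (\<lambda>p. ?X p \<omega>) ?J) = needed j"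
    using j unfolding f_def needed_def required_def
    by (auto simp: fun_eq_iff intro!: arg_cong2[where f = "(-)"] arg_cong2[where f = total] state_before_cong)
  moreover have "g \<circ> (\<lambda>\<omega>. restrict (\<lambda>p. ?X p \<omega>) ?J') = (\<lambda>\<omega>. of_bool (X j k \<omega> \<in> A))"
    by (auto simp: fun_eq_iff g_def)
  ultimately have "indep_var (count_space UNIV) (needed j)
      (count_space UNIV) (\<lambda>\<omega>. of_bool (X j k \<omega> \<in> A))"
    using indep_var_compose[OF iv f g] by simp
  from indep_varD[OF this, of "{k<..}" "{1}"] show ?thesis
    by (simp add: vimage_def Int_def conj_commute of_bool_eq_1_iff del: One_nat_def)
qed

lemma expectation_needed_eq_sum:
  assumes "j \<in> {1..l}"
  shows "expectation (\<lambda>\<omega>. real (needed j \<omega>)) = (\<Sum>k<N. prob {\<omega> \<in> space M. k < needed j \<omega>})"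
proof -
  note [measurable] = measurable_needed[OF assms]
  have "real (needed j \<omega>) = (\<Sum>k<N. indicator {\<omega> \<in> space M. k < needed j \<omega>} \<omega>)" if "\<omega> \<in> space M" for \<omega>
  proof -
    have "{..<N} \<inter> {k. k < needed j \<omega>} = {..<needed j \<omega>}" using needed_le[of j \<omega>] by auto
    then show ?thesis using that by (simp add: indicator_def sum.If_cases)
  qed
  then have "expectation (\<lambda>\<omega>. real (needed j \<omega>)) =
      expectation (\<lambda>\<omega>. \<Sum>k<N. indicator {\<omega> \<in> space M. k < needed j \<omega>} \<omega>)"
    by (intro Bochner_Integration.integral_cong) auto
  also have "\<dots> = (\<Sum>k<N. prob {\<omega> \<in> space M. k < needed j \<omega>})"
    by (subst Bochner_Integration.integral_sum)
      (auto intro!: integrable_real_indicator simp: emeasure_finite less_top[symmetric])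
  finally show ?thesis .
qed

definition reused :: "nat \<Rightarrow> nat \<Rightarrow> 'w \<Rightarrow> nat" where
  "reused j s \<omega> = (\<Sum>k<needed j \<omega>. of_bool (X j k \<omega> \<in> B (r s)))"

text \<open>
  Wald's argument: the expectation of a sum with the random number \<open>needed j\<close> of terms is the sum of the
  probabilities of the events \<open>k < needed j\<close> and \<open>X j k \<in> B (r s)\<close>, and these probabilities factor by
  independence.
\<close>

lemma
  assumes j: "j \<in> {1..l}" and s: "s \<in> {j..l}" "j < l"
  shows integrable_reused: "integrable M (\<lambda>\<omega>. real (reused j s \<omega>))"
    and expectation_reused:
      "expectation (\<lambda>\<omega>. real (reused j s \<omega>)) = expectation (\<lambda>\<omega>. real (needed j \<omega>)) * (r s / r j) ^ d"
proof -
  define E where "E = (\<lambda>k. {\<omega> \<in> space M. k < needed j \<omega> \<and> X j k \<omega> \<in> B (r s)})"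
  note [measurable] = measurable_needed[OF j] measurable_X[OF j]
  have rs: "0 \<le> r s" "r s \<le> r j" "0 < r j"
    using r_nonneg[of s] r_antimono[of j s] r_pos[of j] j s by auto
  note [measurable] = sets_B[OF rs(1)]
  have E [measurable]: "E k \<in> sets M" for k
    unfolding E_def by measurable
  have eq: "real (reused j s \<omega>) = (\<Sum>k<N. indicator (E k) \<omega>)" if "\<omega> \<in> space M" for \<omega>
  proof -
    have "reused j s \<omega> = (\<Sum>k\<in>{..<N} \<inter> {k. k < needed j \<omega>}. of_bool (X j k \<omega> \<in> B (r s)))"
      unfolding reused_def using needed_le[of j \<omega>] by (intro sum.cong) auto
    also have "\<dots> = (\<Sum>k<N. if k < needed j \<omega> then of_bool (X j k \<omega> \<in> B (r s)) else 0)"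
      by (simp only: sum.inter_restrict finite_lessThan mem_Collect_eq)
    finally show ?thesis
      using that by (auto simp: E_def indicator_def intro!: sum.cong simp del: sum_of_bool_eq sum.inter_restrict)
  qed
  have "integrable M (\<lambda>\<omega>. \<Sum>k<N. indicator (E k) \<omega> :: real)"
    by 
      (auto intro!: integrable_real_indicator simp: emeasure_finite less_top[symmetric])
  then show "integrable M (\<lambda>\<omega>. real (reused j s \<omega>))"
    using eq by (simp cong: Bochner_Integration.integrable_cong)
  have "expectation (\<lambda>\<omega>. real (reused j s \<omega>)) = expectation (\<lambda>\<omega>. \<Sum>k<N. indicator (E k) \<omega>)"
    using eq by (intro Bochner_Integration.integral_cong) auto
  also have "\<dots> = (\<Sum>k<N. prob (E k))"
    by (subst Bochner_Integration.integral_sum)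
      (auto intro!: integrable_real_indicator simp: emeasure_finite less_top[symmetric])
  also have "\<dots> = (\<Sum>k<N. prob {\<omega> \<in> space M. k < needed j \<omega>} * (r s / r j) ^ d)"
    unfolding E_def using prob_needed_and_sample[OF j sets_B[OF rs(1)]] prob_X[OF j sets_B[OF rs(1)]]
      measure_uniform_over[OF rs(3,1,2)] by simp
  finally show "expectation (\<lambda>\<omega>. real (reused j s \<omega>)) = expectation (\<lambda>\<omega>. real (needed j \<omega>)) * (r s / r j) ^ d"
    by (simp add: expectation_needed_eq_sum[OF j] sum_distrib_right)
qed

text \<open>
  Both statements hold for every outcome for which each sample lies in the set that it is drawn from.
\<close>

lemma AE_needed_plus_reused: "AE \<omega> in M. \<forall>i\<in>{1..l}. needed i \<omega> + (\<Sum>j=1..<i. reused j i \<omega>) = N"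
  and AE_num_simulations: "AE \<omega> in M. \<forall>i\<in>{1..l}. num_simulations B N l r P X i \<omega> = needed i \<omega>"
proof -
  {
    fix \<omega> assume good: "\<forall>i\<in>{1..l}. \<forall>k. X i k \<omega> \<in> B (r i)"
    let ?x = "\<lambda>i k. X i k \<omega>"
    have size: "size_fun B (?x j k) \<le> r s \<longleftrightarrow> ?x j k \<in> B (r s)" if "j \<in> {1..l}" "s \<in> {1..l}" for j k s
      using good that r_nonneg by (intro size_fun_le_iff[of "r j"]) auto
    have "size_fun B (?x j k) \<le> r j" if "j \<in> {1..l}" for j k
      using size[of j j] good that by simp
    note * = state_before_good_samples[where x = ?x and B = B and r = r and l = l and N = N and P = P,
        OF r_antimono this]
    have "needed i \<omega> + (\<Sum>j=1..<i. reused j i \<omega>) = N" if i: "i \<in> {1..l}" for i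
    proof -
      have "(\<Sum>j=1..<i. reused j i \<omega>) =
          (\<Sum>j=1..<i. \<Sum>k<required B N l r P ?x j. of_bool (size_fun B (?x j k) \<le> r i))"
        unfolding reused_def needed_def using i size by (intro sum.cong) auto
      also have "\<dots> = total (state_before B N l r P ?x i) i"
        using *[of i] i by simp
      finally have "(\<Sum>j=1..<i. reused j i \<omega>) = total (state_before B N l r P ?x i) i" .
      moreover have "total (state_before B N l r P ?x i) i \<le> N"
        using conjunct1[OF conjunct2[OF *[of i]]] i by simp
      ultimately show ?thesis by (simp add: needed_def required_def)
    qed
    moreover have "num_simulations B N l r P X i \<omega> = needed i \<omega>" if "i \<in> {1..l}" for i
      using *[of "Suc l"] that l_pos by (simp add: num_simulations_def run_algorithm_eq needed_def)
    ultimately have "(\<forall>i\<in>{1..l}. needed i \<omega> + (\<Sum>j=1..<i. reused j i \<omega>) = N) \<and>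
      (\<forall>i\<in>{1..l}. num_simulations B N l r P X i \<omega> = needed i \<omega>)" by blast
  }
  with AE_good_samples show "AE \<omega> in M. \<forall>i\<in>{1..l}. needed i \<omega> + (\<Sum>j=1..<i. reused j i \<omega>) = N"
    "AE \<omega> in M. \<forall>i\<in>{1..l}. num_simulations B N l r P X i \<omega> = needed i \<omega>"
    by (auto elim!: AE_mp)
qed

lemma integrable_needed: "i \<in> {1..l} \<Longrightarrow> integrable M (\<lambda>\<omega>. real (needed i \<omega>))"
  using measurable_needed[of i] needed_le by (intro integrable_const_bound[where B = N]) auto

lemma expectation_needed_recurrence:
  assumes i: "i \<in> {1..l}"
  shows "expectation (\<lambda>\<omega>. real (needed i \<omega>)) =
    real N - (\<Sum>j=1..<i. expectation (\<lambda>\<omega>. real (needed j \<omega>)) * (r i / r j) ^ d)"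
proof -
  have int: "integrable M (\<lambda>\<omega>. \<Sum>j=1..<i. real (reused j i \<omega>))"
    using i by (intro Bochner_Integration.integrable_sum integrable_reused) auto
  have "AE \<omega> in M. real (needed i \<omega>) = real N - (\<Sum>j=1..<i. real (reused j i \<omega>))"
    using AE_needed_plus_reused
  proof eventually_elim
    case (elim \<omega>)
    then have "real (needed i \<omega> + (\<Sum>j=1..<i. reused j i \<omega>)) = real N" using i by simp
    then show ?case by simp
  qed
  then have "expectation (\<lambda>\<omega>. real (needed i \<omega>)) =
      expectation (\<lambda>\<omega>. real N - (\<Sum>j=1..<i. real (reused j i \<omega>)))"
    using integrable_needed[OF i] int by (intro integral_cong_AE) auto
  also have "\<dots> = real N - (\<Sum>j=1..<i. expectation (\<lambda>\<omega>. real (reused j i \<omega>)))"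
    using i int by (subst Bochner_Integration.integral_diff)
      (auto simp: prob_space intro!: Bochner_Integration.integral_sum integrable_reused)
  also have "(\<Sum>j=1..<i. expectation (\<lambda>\<omega>. real (reused j i \<omega>))) =
      (\<Sum>j=1..<i. expectation (\<lambda>\<omega>. real (needed j \<omega>)) * (r i / r j) ^ d)"
    using i by (intro sum.cong expectation_reused) auto
  finally show ?thesis .
qed

lemma expectation_needed_first: "expectation (\<lambda>\<omega>. real (needed 1 \<omega>)) = real N"
  using expectation_needed_recurrence[of 1] l_pos by simp

text \<open>
  The sum in the recurrence for \<open>i + 1\<close> has one more term than the sum for \<open>i\<close>. Its term with index \<open>i\<close> is
  \<open>E[n\<^sub>i]\<close> times the factor \<open>(r (i + 1) / r i) ^ d\<close>, and each of its other terms is the corresponding term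
  for \<open>i\<close> times the same factor. By the recurrence for \<open>i\<close> the whole sum is \<open>N\<close> times this factor.
\<close>

lemma expectation_needed_Suc:
  assumes i: "1 \<le> i" "i < l"
  shows "expectation (\<lambda>\<omega>. real (needed (Suc i) \<omega>)) = real N * (1 - (r (Suc i) / r i) ^ d)"
proof -
  let ?e = "\<lambda>j. expectation (\<lambda>\<omega>. real (needed j \<omega>))"
  have split: "{1..<Suc i} = insert i {1..<i}" using i by auto
  have "(\<Sum>j=1..<Suc i. ?e j * (r (Suc i) / r j) ^ d) =
      (\<Sum>j=1..<Suc i. (?e j * (r i / r j) ^ d) * (r (Suc i) / r i) ^ d)"
    using i r_pos[of i] by (intro sum.cong) (auto simp: power_divide)
  also have "\<dots> = (?e i + (\<Sum>j=1..<i. ?e j * (r i / r j) ^ d)) * (r (Suc i) / r i) ^ d"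
    unfolding split using r_pos[of i] i by (simp add: sum_distrib_right distrib_right)
  also have "?e i + (\<Sum>j=1..<i. ?e j * (r i / r j) ^ d) = real N"
    using expectation_needed_recurrence[of i] i by simp
  finally show ?thesis
    using expectation_needed_recurrence[of "Suc i"] i by (simp add: algebra_simps)
qed

lemma measurable_num_simulations:
  "(\<lambda>\<omega>. num_simulations B N l r P X i \<omega>) \<in> measurable M (count_space UNIV)"
  unfolding num_simulations_def run_algorithm_eq
  by (intro measurable_stateD measurable_state_before pred_size_fun_X measurable_X) auto

theorem reuse_factor_eq:
  "reuse_factor M B N l r P X = real l / (real l - (\<Sum>i=2..l. (r i / r (i - 1)) ^ d))"
proof -
  let ?e = "\<lambda>j. expectation (\<lambda>\<omega>. real (needed j \<omega>))"
  have "expectation (\<lambda>\<omega>. real (\<Sum>i=1..l. num_simulations B N l r P X i \<omega>)) =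
      expectation (\<lambda>\<omega>. \<Sum>i=1..l. real (needed i \<omega>))"
  proof (rule integral_cong_AE)
    show "AE \<omega> in M. real (\<Sum>i=1..l. num_simulations B N l r P X i \<omega>) = (\<Sum>i=1..l. real (needed i \<omega>))"
      using AE_num_simulations by eventually_elim simp
    note [measurable] = measurable_num_simulations
    show "(\<lambda>\<omega>. real (\<Sum>i=1..l. num_simulations B N l r P X i \<omega>)) \<in> borel_measurable M"
      by measurable
    show "(\<lambda>\<omega>. \<Sum>i=1..l. real (needed i \<omega>)) \<in> borel_measurable M"
      using integrable_needed by (intro borel_measurable_sum) auto
  qed
  also have "\<dots> = (\<Sum>i=1..l. ?e i)"
    using integrable_needed by (intro Bochner_Integration.integral_sum) auto
  also have "\<dots> = ?e 1 + (\<Sum>i=2..l. ?e i)"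
    using l_pos by (simp add: sum.atLeast_Suc_atMost numeral_2_eq_2)
  also have "(\<Sum>i=2..l. ?e i) = (\<Sum>i=2..l. real N * (1 - (r i / r (i - 1)) ^ d))"
  proof (rule sum.cong)
    fix i assume "i \<in> {2..l}"
    then have "Suc (i - 1) = i" "1 \<le> i - 1" "i - 1 < l" by auto
    then show "?e i = real N * (1 - (r i / r (i - 1)) ^ d)"
      using expectation_needed_Suc[of "i - 1"] by simp
  qed simp
  also have "?e 1 + \<dots> = real N * (real l - (\<Sum>i=2..l. (r i / r (i - 1)) ^ d))"
    unfolding expectation_needed_first using l_pos
    by (simp add: sum_distrib_left[symmetric] sum_subtractf of_nat_diff algebra_simps)
  finally show ?thesis
    using N_pos by (simp add: reuse_factor_def)
qed

end

section \<open>Homogeneous star-shaped bounding sets\<close>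

lemma emeasure_lborel_affine_vimage:
  fixes a :: "'a::euclidean_space"
  assumes "0 < t" "S \<in> sets borel"
  shows "emeasure lborel S = ennreal (t ^ DIM('a)) * emeasure lborel ((\<lambda>x. a + t *\<^sub>R x) -` S)"
proof -
  have "emeasure lborel S =
      emeasure (density (distr lborel borel (\<lambda>x. a + t *\<^sub>R x)) (\<lambda>_. \<bar>t\<bar> ^ DIM('a))) S"
    using assms lborel_affine[of t a] by simp
  also have "\<dots> = ennreal (\<bar>t\<bar> ^ DIM('a)) * emeasure (distr lborel borel (\<lambda>x. a + t *\<^sub>R x)) S"
    using assms by (subst emeasure_density_const) auto
  finally show ?thesis
    using assms by (simp add: emeasure_distr)
qed

lemma homogeneous_family_mono:
  assumes "star_shaped_wrt Q c" "0 \<le> \<rho>" "\<rho> \<le> \<rho>'"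
  shows "homogeneous_family Q c \<rho> \<subseteq> homogeneous_family Q c \<rho>'"
proof
  fix y assume "y \<in> homogeneous_family Q c \<rho>"
  then obtain x where x: "x \<in> Q" "y = \<rho> *\<^sub>R (x - c) + c"
    by (auto simp: homogeneous_family_def)
  show "y \<in> homogeneous_family Q c \<rho>'"
  proof (cases "\<rho>' = 0")
    case True
    then show ?thesis using assms x by (auto simp: homogeneous_family_def)
  next
    case False
    define u where "u = \<rho> / \<rho>'"
    have u: "0 \<le> u" "u \<le> 1" "\<rho>' * u = \<rho>" using assms False by (auto simp: u_def)
    have "(1 - u) *\<^sub>R c + u *\<^sub>R x \<in> closed_segment c x"
      using u by (auto simp: closed_segment_def)
    then have "(1 - u) *\<^sub>R c + u *\<^sub>R x \<in> Q"
      using assms(1) x(1) by (auto simp: star_shaped_wrt_def)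
    moreover have "\<rho>' *\<^sub>R ((1 - u) *\<^sub>R c + u *\<^sub>R x - c) + c = (\<rho>' * u) *\<^sub>R (x - c) + c"
      by (simp add: algebra_simps)
    ultimately show ?thesis
      unfolding x(2) u(3) homogeneous_family_def by force
  qed
qed

text \<open>
  The radii in \<open>{0..\<rho>}\<close> whose set contains \<open>x\<close> form the projection of a compact set of pairs of a radius
  and a point of \<open>Q\<close>. A nonempty compact set of reals has a least element, and monotonicity of the family
  gives all larger radii.
\<close>

lemma homogeneous_family_least_radius:
  fixes Q :: "'a::euclidean_space set"
  assumes Q: "compact Q" "star_shaped_wrt Q c" and \<rho>: "0 \<le> \<rho>" and x: "x \<in> homogeneous_family Q c \<rho>"
  shows "\<exists>m\<ge>0. \<forall>\<sigma>\<ge>0. x \<in> homogeneous_family Q c \<sigma> \<longleftrightarrow> m \<le> \<sigma>"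
proof -
  define C where "C = ({0..\<rho>} \<times> Q) \<inter> {p. fst p *\<^sub>R (snd p - c) + c = x}"
  have "closed {p :: real \<times> 'a. fst p *\<^sub>R (snd p - c) + c = x}"
    by (intro closed_Collect_eq continuous_intros)
  then have "compact (fst ` C)"
    unfolding C_def using Q
    by (intro compact_continuous_image compact_Int_closed compact_Times continuous_intros) auto
  moreover have C: "\<sigma> \<in> fst ` C \<longleftrightarrow> 0 \<le> \<sigma> \<and> \<sigma> \<le> \<rho> \<and> x \<in> homogeneous_family Q c \<sigma>" for \<sigma>
    unfolding C_def homogeneous_family_def by force
  moreover have "\<rho> \<in> fst ` C" using C \<rho> x by blast
  ultimately obtain m where m: "m \<in> fst ` C" "\<And>\<sigma>. \<sigma> \<in> fst ` C \<Longrightarrow> m \<le> \<sigma>"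
    using compact_attains_inf[of "fst ` C"] by blast
  have "x \<in> homogeneous_family Q c \<sigma> \<longleftrightarrow> m \<le> \<sigma>" if "0 \<le> \<sigma>" for \<sigma>
    using that m C homogeneous_family_mono[OF Q(2), of m \<sigma>] by (meson linear order_trans subsetD)
  then show ?thesis using m C by blast
qed

lemma scaling_family_homogeneous_family:
  fixes Q :: "'a::euclidean_space set"
  assumes Q: "compact Q" "0 < measure lborel Q" "c \<in> Q" "star_shaped_wrt Q c"
  shows "scaling_family lborel (homogeneous_family Q c) DIM('a) (measure lborel Q)"
proof
  have image: "homogeneous_family Q c \<rho> = (\<lambda>x. \<rho> *\<^sub>R (x - c) + c) ` Q" for \<rho>
    by (auto simp: homogeneous_family_def)
  have sets: "homogeneous_family Q c \<rho> \<in> sets borel" for \<rho>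
    unfolding image using Q(1)
    by (intro borel_compact compact_continuous_image continuous_intros)
  show "1 \<le> DIM('a)" by (simp add: Suc_leI)
  show "0 < measure lborel Q" by fact
  show "homogeneous_family Q c \<rho> \<in> sets lborel" for \<rho>
    using sets by simp
  show "emeasure lborel (homogeneous_family Q c \<rho>) = ennreal (\<rho> ^ DIM('a) * measure lborel Q)"
    if "0 < \<rho>" for \<rho>
  proof -
    \<comment> \<open>The map \<open>x \<mapsto> \<rho> (x - c) + c\<close>, with its constant part collected in front.\<close>
    have "(\<lambda>x. (c - \<rho> *\<^sub>R c) + \<rho> *\<^sub>R x) -` homogeneous_family Q c \<rho> = Q"
    proof -
      have "(c - \<rho> *\<^sub>R c) + \<rho> *\<^sub>R x = \<rho> *\<^sub>R (y - c) + c \<longleftrightarrow> x = y" for x y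
        using that by (auto simp: algebra_simps)
      then show ?thesis by (auto simp: image)
    qed
    moreover have "emeasure lborel Q = ennreal (measure lborel Q)"
      using emeasure_compact_finite[OF Q(1)] by (intro emeasure_eq_ennreal_measure) auto
    ultimately show ?thesis
      using emeasure_lborel_affine_vimage[OF that sets[of \<rho>], of "c - \<rho> *\<^sub>R c"] that
      by (simp add: ennreal_mult)
  qed
  show "homogeneous_family Q c \<rho> \<subseteq> homogeneous_family Q c \<rho>'" if "0 \<le> \<rho>" "\<rho> \<le> \<rho>'" for \<rho> \<rho>'
    using homogeneous_family_mono[OF Q(4) that] .
  show "\<exists>m\<ge>0. \<forall>\<sigma>\<ge>0. x \<in> homogeneous_family Q c \<sigma> \<longleftrightarrow> m \<le> \<sigma>"
    if "0 \<le> \<rho>" "x \<in> homogeneous_family Q c \<rho>" for \<rho> x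
    using homogeneous_family_least_radius[OF Q(1,4) that] .
  show "\<exists>z. homogeneous_family Q c 0 = {z}"
    using Q(3) by (auto simp: homogeneous_family_def)
qed

section \<open>Balls of the \<open>p\<close>-norms\<close>

lemma mem_lp_ball_enat:
  assumes "1 \<le> k" "0 \<le> \<rho>"
  shows "x \<in> lp_ball (enat k) \<rho> \<longleftrightarrow> (\<Sum>i\<in>UNIV. \<bar>vec_nth x i\<bar> ^ k) \<le> \<rho> ^ k"
proof -
  have "root k (\<rho> ^ k) = \<rho>" using assms by (simp add: real_root_power_cancel)
  then show ?thesis
    using assms real_root_le_iff[of k "\<Sum>i\<in>UNIV. \<bar>vec_nth x i\<bar> ^ k" "\<rho> ^ k"]
    by (simp add: lp_ball_def lp_norm_def)
qed

lemma mem_lp_ball_infinity: "x \<in> lp_ball \<infinity> \<rho> \<longleftrightarrow> (\<forall>i. \<bar>vec_nth x i\<bar> \<le> \<rho>)"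
  by (auto simp: lp_ball_def lp_norm_def)

lemma lp_ball_component_le:
  assumes p: "1 \<le> p" and \<rho>: "0 \<le> \<rho>" and x: "x \<in> lp_ball p \<rho>"
  shows "\<bar>vec_nth x i\<bar> \<le> \<rho>"
proof (cases p)
  case (enat k)
  then have k: "1 \<le> k" using p by (simp add: one_enat_def)
  have "\<bar>vec_nth x i\<bar> ^ k \<le> (\<Sum>i\<in>UNIV. \<bar>vec_nth x i\<bar> ^ k)"
    by (intro member_le_sum) auto
  also have "\<dots> \<le> \<rho> ^ k" using x enat mem_lp_ball_enat[OF k \<rho>, of x] by simp
  finally show ?thesis using k \<rho> by (simp add: power_mono_iff)
qed (use x in \<open>simp add: mem_lp_ball_infinity\<close>)

lemma scaleR_mem_lp_ball:
  assumes p: "1 \<le> p" and "0 \<le> t" "0 \<le> \<rho>" and x: "x \<in> lp_ball p \<rho>"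
  shows "t *\<^sub>R x \<in> lp_ball p (t * \<rho>)"
proof (cases p)
  case (enat k)
  then have k: "1 \<le> k" using p by (simp add: one_enat_def)
  show ?thesis
    using enat x assms(2,3)
    by (auto simp: mem_lp_ball_enat[OF k] abs_mult power_mult_distrib sum_distrib_left[symmetric]
        intro: mult_left_mono)
qed (use assms in \<open>auto simp: mem_lp_ball_infinity abs_mult intro: mult_left_mono\<close>)

lemma lp_ball_mono:
  assumes p: "1 \<le> p" and "0 \<le> \<rho>" "\<rho> \<le> \<rho>'"
  shows "lp_ball p \<rho> \<subseteq> lp_ball p \<rho>'"
  using assms by (auto simp: lp_ball_def)

lemma zero_mem_lp_ball:
  assumes p: "1 \<le> p" and "0 \<le> \<rho>"
  shows "0 \<in> lp_ball p \<rho>"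
proof (cases p)
  case (enat k)
  then have k: "1 \<le> k" using p by (simp add: one_enat_def)
  then show ?thesis using enat assms(2) mem_lp_ball_enat[OF k assms(2), of 0] by (simp add: power_0_left)
qed (use assms in \<open>simp add: mem_lp_ball_infinity\<close>)

text \<open>
  The equality is restricted to nonnegative radii: for \<open>\<rho> < 0\<close> the left side is empty and the right side is
  a reflected ball.
\<close>

lemma lp_ball_eq_homogeneous_family:
  assumes p: "1 \<le> p" and \<rho>: "0 \<le> \<rho>"
  shows "lp_ball p \<rho> = homogeneous_family (lp_ball p 1) 0 \<rho>"
proof (cases "\<rho> = 0")
  case True
  have "x = 0" if "x \<in> lp_ball p 0" for x :: "real ^ 'n"
    using lp_ball_component_le[OF p _ that] by (simp add: Finite_Cartesian_Product.vec_eq_iff)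
  then show ?thesis
    using True zero_mem_lp_ball[OF p, of 0] zero_mem_lp_ball[OF p, of 1]
    by (auto simp: homogeneous_family_def)
next
  case False
  have "x \<in> homogeneous_family (lp_ball p 1) 0 \<rho>" if "x \<in> lp_ball p \<rho>" for x :: "real ^ 'n"
    using scaleR_mem_lp_ball[OF p _ _ that, of "1 / \<rho>"] False \<rho>
    by (force simp: homogeneous_family_def intro!: exI[of _ "(1 / \<rho>) *\<^sub>R x"])
  then show ?thesis
    using scaleR_mem_lp_ball[OF p \<rho>, of 1] by (auto simp: homogeneous_family_def)
qed

lemma compact_unit_lp_ball:
  assumes p: "1 \<le> p"
  shows "compact (lp_ball p 1 :: (real ^ 'n) set)"
proof -
  have "closed (lp_ball p 1 :: (real ^ 'n) set)"
  proof (cases p)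
    case (enat k)
    then have k: "1 \<le> k" using p by (simp add: one_enat_def)
    have eq: "lp_ball p 1 = {x :: real ^ 'n. (\<Sum>i\<in>UNIV. \<bar>vec_nth x i\<bar> ^ k) \<le> 1}"
      using mem_lp_ball_enat[OF k, of 1] enat by auto
    show ?thesis unfolding eq by (intro closed_Collect_le continuous_intros)
  next
    case infinity
    have eq: "lp_ball p 1 = {x :: real ^ 'n. \<forall>i. \<bar>vec_nth x i\<bar> \<le> 1}"
      using infinity mem_lp_ball_infinity by auto
    show ?thesis unfolding eq by (intro closed_Collect_all closed_Collect_le continuous_intros)
  qed
  moreover have "lp_ball p 1 \<subseteq> (cbox (- 1) 1 :: (real ^ 'n) set)"
    using lp_ball_component_le[OF p, of 1] by (fastforce simp: mem_box_cart abs_le_iff)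
  ultimately show ?thesis
    using bounded_cbox bounded_subset compact_eq_bounded_closed by blast
qed

text \<open>
  On a cube of half side \<open>1 / n\<close> each of the \<open>n\<close> terms \<open>\<bar>x\<^sub>i\<bar>\<^sup>k\<close> is at most \<open>1 / n\<close>, for every \<open>k \<ge> 1\<close>
  at once. Its purpose is to show that the unit ball has positive volume.
\<close>

lemma cbox_subset_unit_lp_ball:
  assumes p: "1 \<le> p"
  shows "cbox (- (1 / CARD('n)) *\<^sub>R 1) ((1 / CARD('n)) *\<^sub>R 1) \<subseteq> (lp_ball p 1 :: (real ^ 'n) set)"
proof
  fix x :: "real ^ 'n"
  assume "x \<in> cbox (- (1 / CARD('n)) *\<^sub>R 1) ((1 / CARD('n)) *\<^sub>R 1)"
  then have x: "\<bar>vec_nth x i\<bar> \<le> 1 / CARD('n)" for i by (auto simp: mem_box_cart abs_le_iff) (smt (verit))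
  have le_1: "1 / real CARD('n) \<le> 1" by (simp add: Suc_leI)
  show "x \<in> lp_ball p 1"
  proof (cases p)
    case (enat k)
    then have k: "1 \<le> k" using p by (simp add: one_enat_def)
    have "\<bar>vec_nth x i\<bar> ^ k \<le> 1 / CARD('n)" for i
    proof -
      have "\<bar>vec_nth x i\<bar> ^ k \<le> \<bar>vec_nth x i\<bar> ^ 1"
        using k order_trans[OF x le_1] by (intro power_decreasing) auto
      then show ?thesis using x[of i] by simp
    qed
    then have "(\<Sum>i\<in>UNIV. \<bar>vec_nth x i\<bar> ^ k) \<le> (\<Sum>i\<in>(UNIV :: 'n set). 1 / CARD('n))"
      by (intro sum_mono)
    then show ?thesis using enat mem_lp_ball_enat[OF k, of 1 x] by simp
  next
    case infinity
    then show ?thesis using x le_1 mem_lp_ball_infinity[of x 1] order_trans by blast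
  qed
qed

lemma measure_unit_lp_ball_pos:
  assumes p: "1 \<le> p"
  shows "0 < measure lborel (lp_ball p 1 :: (real ^ 'n) set)"
proof -
  let ?C = "cbox (- (1 / CARD('n)) *\<^sub>R 1) ((1 / CARD('n)) *\<^sub>R 1) :: (real ^ 'n) set"
  have "0 \<in> box (- (1 / CARD('n)) *\<^sub>R 1) ((1 / CARD('n)) *\<^sub>R 1 :: real ^ 'n)"
    by (simp add: mem_box_cart)
  then have "0 < measure lborel ?C"
    using box_ne_empty(2) by (intro content_pos_lt) blast
  also have "\<dots> \<le> measure lborel (lp_ball p 1 :: (real ^ 'n) set)"
    using cbox_subset_unit_lp_ball[OF p] compact_unit_lp_ball[OF p] borel_compact[OF compact_unit_lp_ball[OF p]]
      emeasure_compact_finite[OF compact_unit_lp_ball[OF p]]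
    by (intro measure_mono_fmeasurable) (auto simp: fmeasurable_def)
  finally show ?thesis .
qed

lemma star_shaped_unit_lp_ball:
  assumes p: "1 \<le> p"
  shows "star_shaped_wrt (lp_ball p 1) 0"
proof -
  have "u *\<^sub>R x \<in> lp_ball p 1" if "x \<in> lp_ball p 1" "0 \<le> u" "u \<le> 1" for u and x :: "real ^ 'n"
    using scaleR_mem_lp_ball[OF p that(2) _ that(1)] lp_ball_mono[OF p that(2,3)] by auto
  then show ?thesis by (auto simp: star_shaped_wrt_def closed_segment_def)
qed

lemma (in scaling_family) scaling_family_cong:
  assumes "\<And>\<rho>. 0 \<le> \<rho> \<Longrightarrow> B' \<rho> = B \<rho>"
  shows "scaling_family vol B' d K"
proof
  show "\<exists>m\<ge>0. \<forall>\<sigma>\<ge>0. x \<in> B' \<sigma> \<longleftrightarrow> m \<le> \<sigma>" if "0 \<le> \<rho>" "x \<in> B' \<rho>" for \<rho> x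
    using least_radius[of \<rho> x] that assms by simp
qed (use assms dim_pos unit_vol_pos sets_B emeasure_B_pos B_mono B_0 in auto)

lemma scaling_family_lp_ball:
  assumes "1 \<le> p"
  shows "scaling_family lborel (lp_ball p :: real \<Rightarrow> (real ^ 'n) set) CARD('n)
    (measure lborel (lp_ball p 1 :: (real ^ 'n) set))"
  using scaling_family.scaling_family_cong[OF scaling_family_homogeneous_family[OF
      compact_unit_lp_ball[OF assms] measure_unit_lp_ball_pos[OF assms]
      zero_mem_lp_ball[OF assms zero_le_one] star_shaped_unit_lp_ball[OF assms]]
      lp_ball_eq_homogeneous_family[OF assms]]
  by simp

section \<open>The largest singular value\<close>

definition gram :: "complex mat \<Rightarrow> complex mat" where
  "gram A = mat_adjoint A * A"

definition frobenius_square :: "complex mat \<Rightarrow> real" where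
  "frobenius_square A = (\<Sum>i<dim_col A. \<Sum>a<dim_row A. (cmod (A $$ (a, i)))\<^sup>2)"

lemma mat_adjoint_carrier: "A \<in> carrier_mat n m \<Longrightarrow> mat_adjoint A \<in> carrier_mat m n"
  by (auto simp: mat_adjoint_def mat_of_rows_def)

lemma index_mat_adjoint:
  "A \<in> carrier_mat n m \<Longrightarrow> i < m \<Longrightarrow> a < n \<Longrightarrow> mat_adjoint A $$ (i, a) = cnj (A $$ (a, i))"
  by (auto simp: mat_adjoint_def mat_of_rows_index)

lemma gram_carrier: "A \<in> carrier_mat n m \<Longrightarrow> gram A \<in> carrier_mat m m"
  unfolding gram_def using mat_adjoint_carrier by (intro mult_carrier_mat) auto

lemma index_gram:
  assumes A: "A \<in> carrier_mat n m" and "i < m" "j < m"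
  shows "gram A $$ (i, j) = (\<Sum>a<n. cnj (A $$ (a, i)) * A $$ (a, j))"
proof -
  have "gram A $$ (i, j) = row (mat_adjoint A) i \<bullet> col A j"
    unfolding gram_def using assms mat_adjoint_carrier[OF A] by (intro index_mult_mat) auto
  also have "\<dots> = (\<Sum>a = 0..<n. row (mat_adjoint A) i $ a * col A j $ a)"
    using A by (simp add: scalar_prod_def)
  also have "\<dots> = (\<Sum>a = 0..<n. cnj (A $$ (a, i)) * A $$ (a, j))"
    using assms mat_adjoint_carrier[OF A] by (intro sum.cong) (auto simp: index_mat_adjoint[OF A])
  finally show ?thesis by (simp add: atLeast0LessThan)
qed

lemma trace_gram:
  assumes A: "A \<in> carrier_mat n m"
  shows "(\<Sum>i<m. gram A $$ (i, i)) = of_real (frobenius_square A)"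
proof -
  have "cnj z * z = of_real ((cmod z)\<^sup>2)" for z
    by (metis complex_norm_square mult.commute)
  then show ?thesis
    using A by (simp add: index_gram[OF A] frobenius_square_def)
qed

text \<open>
  If \<open>A\<^sup>* A v = e v\<close>, then the inner product with \<open>v\<close> yields \<open>e \<parallel>v\<parallel>\<^sup>2 = \<parallel>A v\<parallel>\<^sup>2\<close>.
\<close>

lemma eigenvalue_gram_real_nonneg:
  assumes A: "A \<in> carrier_mat n m" and e: "eigenvalue (gram A) e"
  shows "e = of_real (Re e)" "0 \<le> Re e"
proof -
  obtain v where v: "v \<in> carrier_vec m" "v \<noteq> 0\<^sub>v m" and ev: "gram A *\<^sub>v v = e \<cdot>\<^sub>v v"
    using e gram_carrier[OF A] by (auto simp: eigenvalue_def eigenvector_def)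
  define w where "w = A *\<^sub>v v"
  have w: "w \<in> carrier_vec n" using A v by (simp add: w_def)
  have w_ind: "w $ a = (\<Sum>i<m. A $$ (a, i) * v $ i)" if "a < n" for a
    using A v that by (simp add: w_def scalar_prod_def atLeast0LessThan)
  have "gram A *\<^sub>v v = mat_adjoint A *\<^sub>v w"
    unfolding w_def gram_def using assoc_mult_mat_vec[OF mat_adjoint_carrier[OF A] A v(1)] .
  then have ev_ind: "e * v $ i = (\<Sum>a<n. cnj (A $$ (a, i)) * w $ a)" if i: "i < m" for i
  proof -
    have "e * v $ i = (mat_adjoint A *\<^sub>v w) $ i"
      using ev v i \<open>gram A *\<^sub>v v = mat_adjoint A *\<^sub>v w\<close> by (metis carrier_vecD index_smult_vec(1))
    also have "\<dots> = (\<Sum>a = 0..<n. row (mat_adjoint A) i $ a * w $ a)"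
      using i w mat_adjoint_carrier[OF A] by (simp add: scalar_prod_def)
    also have "\<dots> = (\<Sum>a = 0..<n. cnj (A $$ (a, i)) * w $ a)"
      using i mat_adjoint_carrier[OF A] by (intro sum.cong) (auto simp: index_mat_adjoint[OF A])
    finally show ?thesis by (simp add: atLeast0LessThan)
  qed
  have sq: "cnj z * z = of_real ((cmod z)\<^sup>2)" for z
    by (metis complex_norm_square mult.commute)
  define V where "V = (\<Sum>i<m. (cmod (v $ i))\<^sup>2)"
  define W where "W = (\<Sum>a<n. (cmod (w $ a))\<^sup>2)"
  have "e * of_real V = (\<Sum>i<m. cnj (v $ i) * (e * v $ i))"
    unfolding V_def of_real_sum sum_distrib_left sq[symmetric] by (intro sum.cong) auto
  also have "\<dots> = (\<Sum>i<m. \<Sum>a<n. cnj (A $$ (a, i) * v $ i) * w $ a)"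
    by (intro sum.cong) (auto simp: ev_ind sum_distrib_left ac_simps)
  also have "\<dots> = (\<Sum>a<n. \<Sum>i<m. cnj (A $$ (a, i) * v $ i) * w $ a)"
    by (rule sum.swap)
  also have "\<dots> = (\<Sum>a<n. cnj (w $ a) * w $ a)"
    by (intro sum.cong) (auto simp: w_ind sum_distrib_right)
  also have "\<dots> = of_real W" by (simp add: W_def sq)
  finally have eVW: "e * of_real V = of_real W" .
  obtain i where i: "i < m" "v $ i \<noteq> 0"
    using v by (metis carrier_vecD eq_vecI index_zero_vec(1) index_zero_vec(2))
  have "(cmod (v $ i))\<^sup>2 \<le> V"
    unfolding V_def using i by (intro member_le_sum) auto
  then have V: "0 < V" using i by (smt (verit) zero_less_norm_iff zero_less_power)
  have W: "0 \<le> W" by (simp add: W_def sum_nonneg)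
  have "e = of_real (W / V)" using eVW V by (simp add: field_simps)
  then show "e = of_real (Re e)" "0 \<le> Re e" using V W by auto
qed

lemma trace_similar:
  fixes G :: "'a::comm_ring_1 mat"
  assumes "G \<in> carrier_mat m m" "H \<in> carrier_mat m m"
  shows "(\<Sum>i<m. (G * H) $$ (i, i)) = (\<Sum>i<m. (H * G) $$ (i, i))"
proof -
  have ind: "(X * Y) $$ (i, i) = (\<Sum>j<m. X $$ (i, j) * Y $$ (j, i))"
    if "X \<in> carrier_mat m m" "Y \<in> carrier_mat m m" "i < m" for X Y :: "'a mat" and i
    using that by (simp add: scalar_prod_def atLeast0LessThan)
  have "(\<Sum>i<m. (G * H) $$ (i, i)) = (\<Sum>i<m. \<Sum>j<m. G $$ (i, j) * H $$ (j, i))"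
    using ind assms by (intro sum.cong) auto
  also have "\<dots> = (\<Sum>j<m. \<Sum>i<m. H $$ (j, i) * G $$ (i, j))"
    by (subst sum.swap) (simp add: mult.commute)
  also have "\<dots> = (\<Sum>i<m. (H * G) $$ (i, i))"
    using ind assms by (intro sum.cong) auto
  finally show ?thesis .
qed

text \<open>
  Schur decomposition: \<open>G\<close> is similar to an upper triangular matrix with the eigenvalues on its diagonal,
  and the trace is invariant under similarity.
\<close>

lemma trace_eq_sum_eigenvalues:
  fixes G :: "complex mat"
  assumes G: "G \<in> carrier_mat m m" and es: "char_poly G = (\<Prod>e\<leftarrow>es. [:- e, 1:])"
  shows "(\<Sum>i<m. G $$ (i, i)) = sum_list es"
proof -
  obtain C P Q where CPQ: "schur_decomposition G es = (C, P, Q)" by (metis prod_cases3)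
  have wit: "similar_mat_wit G C P Q" and diag: "diag_mat C = es"
    using schur_decomposition[OF G es CPQ] by auto
  note c = similar_mat_witD2(5-7)[OF G wit]
    and QP = similar_mat_witD2(2)[OF G wit] and eq = similar_mat_witD2(3)[OF G wit]
  have "(\<Sum>i<m. G $$ (i, i)) = (\<Sum>i<m. (Q * (P * C)) $$ (i, i))"
    using trace_similar[of "P * C" m Q] c by (simp only: eq mult_carrier_mat)
  also have "Q * (P * C) = C"
    using assoc_mult_mat[of Q m m P m C m] QP c by simp
  also have "(\<Sum>i<m. C $$ (i, i)) = sum_list (diag_mat C)"
    using c by (simp add: diag_mat_def sum_list_sum_nth atLeast0LessThan)
  finally show ?thesis by (simp add: diag)
qed

text \<open>
  This identity replaces the variational description of the largest singular value: since the eigenvalues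
  are nonnegative, it bounds the largest of them by the squared Frobenius norm, and the squared Frobenius
  norm by the number of columns times the largest.
\<close>

lemma frobenius_square_eq_sum_eigenvalues:
  assumes A: "A \<in> carrier_mat n m"
  obtains es where "set es = {e. eigenvalue (gram A) e}" "length es = m"
    "frobenius_square A = (\<Sum>e\<leftarrow>es. Re e)"
proof -
  note G = gram_carrier[OF A]
  obtain es where es: "char_poly (gram A) = (\<Prod>e\<leftarrow>es. [:- e, 1:])" "length es = m"
    using char_poly_factorized[OF G] by blast
  have "set es = {e. eigenvalue (gram A) e}"
    by (auto simp: eigenvalue_root_char_poly[OF G] es(1) poly_prod_list prod_list_zero_iff)
  moreover have "complex_of_real (frobenius_square A) = sum_list es"
    using trace_eq_sum_eigenvalues[OF G es(1)] trace_gram[OF A] by simp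
  then have "frobenius_square A = Re (sum_list es)"
    by (metis Re_complex_of_real)
  moreover have "Re (sum_list zs) = (\<Sum>z\<leftarrow>zs. Re z)" for zs
    by (induction zs) auto
  ultimately show ?thesis using es(2) that by simp
qed

lemma
  assumes A: "A \<in> carrier_mat n m" and m: "1 \<le> m"
  shows largest_singular_value_nonneg: "0 \<le> largest_singular_value A"
    and largest_singular_value_le_iff:
      "0 \<le> \<rho> \<Longrightarrow> largest_singular_value A \<le> \<rho> \<longleftrightarrow> (\<forall>e. eigenvalue (gram A) e \<longrightarrow> Re e \<le> \<rho>\<^sup>2)"
proof -
  obtain es where es: "set es = {e. eigenvalue (gram A) e}" "length es = m"
      "frobenius_square A = (\<Sum>e\<leftarrow>es. Re e)"
    by (rule frobenius_square_eq_sum_eigenvalues[OF A])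
  have sv: "singular_values A = (\<lambda>e. sqrt (Re e)) ` set es"
    unfolding singular_values_def gram_def[symmetric] es(1) by auto
  have fin: "finite (singular_values A)" "singular_values A \<noteq> {}"
    unfolding sv using es(2) m by auto
  then have "largest_singular_value A \<in> singular_values A"
    unfolding largest_singular_value_def by (rule Max_in)
  then show "0 \<le> largest_singular_value A"
    using eigenvalue_gram_real_nonneg(2)[OF A] by (auto simp: sv es(1))
  show "largest_singular_value A \<le> \<rho> \<longleftrightarrow> (\<forall>e. eigenvalue (gram A) e \<longrightarrow> Re e \<le> \<rho>\<^sup>2)" if "0 \<le> \<rho>"
  proof -
    have "sqrt x \<le> \<rho> \<longleftrightarrow> x \<le> \<rho>\<^sup>2" for x
      using real_sqrt_le_iff[of x "\<rho>\<^sup>2"] that by simp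
    then show ?thesis
      using fin by (auto simp: largest_singular_value_def sv es(1))
  qed
qed

lemma largest_singular_value_le_frobenius:
  assumes A: "A \<in> carrier_mat n m" and m: "1 \<le> m" and \<rho>: "0 \<le> \<rho>" "frobenius_square A \<le> \<rho>\<^sup>2"
  shows "largest_singular_value A \<le> \<rho>"
proof -
  obtain es where es: "set es = {e. eigenvalue (gram A) e}" "length es = m"
      "frobenius_square A = (\<Sum>e\<leftarrow>es. Re e)"
    by (rule frobenius_square_eq_sum_eigenvalues[OF A])
  have "Re e \<le> (\<Sum>e\<leftarrow>es. Re e)" if "e \<in> set es" for e
  proof (rule member_le_sum_list)
    show "Re e \<in> set (map Re es)" using that by simp
    show "0 \<le> x" if "x \<in> set (map Re es)" for x
      using that es(1) eigenvalue_gram_real_nonneg(2)[OF A] by auto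
  qed
  then show ?thesis
    using es \<rho> by (force simp: largest_singular_value_le_iff[OF A m])
qed

lemma frobenius_square_le_largest_singular_value:
  assumes A: "A \<in> carrier_mat n m" and m: "1 \<le> m" and \<rho>: "0 \<le> \<rho>" "largest_singular_value A \<le> \<rho>"
  shows "frobenius_square A \<le> real m * \<rho>\<^sup>2"
proof -
  obtain es where es: "set es = {e. eigenvalue (gram A) e}" "length es = m"
      "frobenius_square A = (\<Sum>e\<leftarrow>es. Re e)"
    by (rule frobenius_square_eq_sum_eigenvalues[OF A])
  have "(\<Sum>e\<leftarrow>es. Re e) \<le> (\<Sum>e\<leftarrow>es. \<rho>\<^sup>2)"
    using \<rho> es(1) largest_singular_value_le_iff[OF A m \<rho>(1)] by (intro sum_list_mono) auto
  then show ?thesis using es by (simp add: sum_list_triv)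
qed

lemma cmod_entry_le_frobenius:
  assumes A: "A \<in> carrier_mat n m" and "a < n" "i < m"
  shows "(cmod (A $$ (a, i)))\<^sup>2 \<le> frobenius_square A"
proof -
  have "(cmod (A $$ (a, i)))\<^sup>2 \<le> (\<Sum>a<n. (cmod (A $$ (a, i)))\<^sup>2)"
    using assms by (intro member_le_sum) auto
  also have "\<dots> \<le> (\<Sum>i<m. \<Sum>a<n. (cmod (A $$ (a, i)))\<^sup>2)"
    using assms by (intro member_le_sum[of i _ "\<lambda>i. \<Sum>a<n. (cmod (A $$ (a, i)))\<^sup>2"]) (auto intro: sum_nonneg)
  finally show ?thesis using A by (simp add: frobenius_square_def)
qed

lemma frobenius_square_le:
  assumes A: "A \<in> carrier_mat n m" and le: "\<And>a i. a < n \<Longrightarrow> i < m \<Longrightarrow> cmod (A $$ (a, i)) \<le> \<epsilon>"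
  shows "frobenius_square A \<le> real (m * n) * \<epsilon>\<^sup>2"
proof -
  have "frobenius_square A \<le> (\<Sum>i<m. \<Sum>a<n. \<epsilon>\<^sup>2)"
    unfolding frobenius_square_def carrier_matD[OF A] using le by (intro sum_mono power_mono) auto
  then show ?thesis by simp
qed

lemma largest_singular_value_smult_le:
  assumes A: "A \<in> carrier_mat n m" and m: "1 \<le> m" and t: "0 < t"
    and \<rho>: "0 \<le> \<rho>" "largest_singular_value A \<le> \<rho>"
  shows "largest_singular_value (of_real t \<cdot>\<^sub>m A) \<le> t * \<rho>"
proof -
  let ?A = "of_real t \<cdot>\<^sub>m A"
  have A': "?A \<in> carrier_mat n m" using A by simp
  have gram: "gram ?A = of_real (t\<^sup>2) \<cdot>\<^sub>m gram A"
    using gram_carrier[OF A] gram_carrier[OF A'] A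
    by (intro eq_matI)
      (auto simp: index_gram[OF A] index_gram[OF A'] sum_distrib_left power2_eq_square ac_simps
        intro!: sum.cong)
  have "Re e \<le> (t * \<rho>)\<^sup>2" if e: "eigenvalue (gram ?A) e" for e
  proof -
    obtain v where v: "v \<in> carrier_vec m" "v \<noteq> 0\<^sub>v m" "gram ?A *\<^sub>v v = e \<cdot>\<^sub>v v"
      using e gram_carrier[OF A'] by (auto simp: eigenvalue_def eigenvector_def)
    have "gram A *\<^sub>v v = (e / of_real (t\<^sup>2)) \<cdot>\<^sub>v v"
    proof (rule eq_vecI)
      fix i assume "i < dim_vec ((e / of_real (t\<^sup>2)) \<cdot>\<^sub>v v)"
      then have i: "i < m" using v by simp
      have "(gram ?A *\<^sub>v v) $ i = of_real (t\<^sup>2) * (gram A *\<^sub>v v) $ i"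
        using i v(1) gram_carrier[OF A] unfolding gram
        by (simp add: scalar_prod_def sum_distrib_left ac_simps)
      then show "(gram A *\<^sub>v v) $ i = ((e / of_real (t\<^sup>2)) \<cdot>\<^sub>v v) $ i"
        using v i t by (simp add: field_simps)
    qed (use v gram_carrier[OF A] in auto)
    then have "eigenvalue (gram A) (e / of_real (t\<^sup>2))"
      using v gram_carrier[OF A] by (auto simp: eigenvalue_def eigenvector_def)
    then have "Re (e / of_real (t\<^sup>2)) \<le> \<rho>\<^sup>2"
      using largest_singular_value_le_iff[OF A m \<rho>(1)] \<rho>(2) by blast
    then show ?thesis using t by (simp add: power_mult_distrib field_simps del: of_real_power)
  qed
  then show ?thesis
    using largest_singular_value_le_iff[OF A' m, of "t * \<rho>"] t \<rho>(1) by simp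
qed

subsection \<open>Measurability\<close>

text \<open>
  A continuous function without zeros on a compact interval is bounded away from zero. Conversely, a
  positive lower bound at the rational points excludes zeros, because every point of the interval is a
  limit of rational points in it; this direction requires a nondegenerate interval.
\<close>

lemma no_zero_on_interval_iff_rational:
  fixes f :: "real \<Rightarrow> complex"
  assumes "a < b" and f: "continuous_on {a..b} f"
  shows "(\<forall>x\<in>{a..b}. f x \<noteq> 0) \<longleftrightarrow>
    (\<exists>k::nat. \<forall>q::rat. of_rat q \<in> {a..b} \<longrightarrow> 1 / (real k + 1) \<le> cmod (f (of_rat q)))"
proof
  assume nz: "\<forall>x\<in>{a..b}. f x \<noteq> 0"
  have "continuous_on {a..b} (\<lambda>x. cmod (f x))" by (intro continuous_on_norm f)
  then have "\<exists>x\<in>{a..b}. \<forall>y\<in>{a..b}. cmod (f x) \<le> cmod (f y)"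
    using assms(1) by (intro continuous_attains_inf) auto
  then obtain x where x: "x \<in> {a..b}" "\<And>y. y \<in> {a..b} \<Longrightarrow> cmod (f x) \<le> cmod (f y)"
    by blast
  obtain k where "inverse (real (Suc k)) < cmod (f x)"
    using reals_Archimedean[of "cmod (f x)"] nz x(1) by auto
  then have "1 / (real k + 1) \<le> cmod (f y)" if "y \<in> {a..b}" for y
    using x(2)[OF that] by (simp add: inverse_eq_divide add.commute)
  then show "\<exists>k::nat. \<forall>q::rat. of_rat q \<in> {a..b} \<longrightarrow> 1 / (real k + 1) \<le> cmod (f (of_rat q))"
    by blast
next
  assume "\<exists>k::nat. \<forall>q::rat. of_rat q \<in> {a..b} \<longrightarrow> 1 / (real k + 1) \<le> cmod (f (of_rat q))"
  then obtain k :: nat where k: "\<And>q::rat. of_rat q \<in> {a..b} \<Longrightarrow> 1 / (real k + 1) \<le> cmod (f (of_rat q))"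
    by blast
  show "\<forall>x\<in>{a..b}. f x \<noteq> 0"
  proof (intro ballI notI)
    fix x assume x: "x \<in> {a..b}" "f x = 0"
    have "0 < 1 / (real k + 1)" by simp
    from f[unfolded continuous_on_iff, rule_format, OF x(1) this] obtain \<delta> where \<delta>: "\<delta> > 0"
      "\<And>y. y \<in> {a..b} \<Longrightarrow> dist y x < \<delta> \<Longrightarrow> dist (f y) (f x) < 1 / (real k + 1)"
      by blast
    have "max a (x - \<delta>) < min b (x + \<delta>)" using \<delta>(1) x(1) assms(1) by auto
    then obtain y where "y \<in> \<rat>" "max a (x - \<delta>) < y" "y < min b (x + \<delta>)"
      using Rats_dense_in_real by blast
    then obtain q :: rat where q: "max a (x - \<delta>) < of_rat q" "of_rat q < min b (x + \<delta>)"
      by (auto elim: Rats_cases)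
    then have "of_rat q \<in> {a..b}" "dist (of_rat q) x < \<delta>" by (auto simp: dist_real_def abs_less_iff)
    then show False using k[of q] \<delta>(2)[of "of_rat q"] x(2) by simp
  qed
qed

definition measurable_mat :: "'w measure \<Rightarrow> nat \<Rightarrow> nat \<Rightarrow> ('w \<Rightarrow> complex mat) \<Rightarrow> bool" where
  "measurable_mat M n m A \<longleftrightarrow> (\<forall>\<omega>\<in>space M. A \<omega> \<in> carrier_mat n m) \<and>
     (\<forall>a<n. \<forall>b<m. (\<lambda>\<omega>. A \<omega> $$ (a, b)) \<in> borel_measurable M)"

lemma det_char_matrix:
  fixes G :: "complex mat"
  assumes "G \<in> carrier_mat m m"
  shows "det (char_matrix G e) =
    (\<Sum>p | p permutes {0..<m}. signof p * (\<Prod>i = 0..<m. G $$ (i, p i) - (if i = p i then e else 0)))"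
proof -
  have "char_matrix G e $$ (i, p i) = G $$ (i, p i) - (if i = p i then e else 0)"
    if "p permutes {0..<m}" "i \<in> {0..<m}" for p i
    using that assms permutes_in_image[OF that(1), of i] by (auto simp: char_matrix_def)
  then show ?thesis
    using assms by (subst det_def'[of _ m]) (auto simp: char_matrix_def intro!: sum.cong prod.cong)
qed

text \<open>
  The condition says that \<open>det (A\<^sup>* A - x)\<close> has no zero \<open>x > \<rho>\<^sup>2\<close>. The open half-line is exhausted by the
  compact intervals from \<open>\<rho>\<^sup>2 + 1 / (j + 1)\<close> to \<open>\<rho>\<^sup>2 + j + 2\<close>, so that the condition becomes a countable
  combination of conditions on values of the determinant at rational points. Each such value is a
  polynomial in the entries of \<open>A\<close> and their conjugates, hence measurable.
\<close>

lemma largest_singular_value_le_iff_rational: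
  assumes A: "A \<in> carrier_mat n m" and m: "1 \<le> m" and \<rho>: "0 \<le> \<rho>"
  shows "largest_singular_value A \<le> \<rho> \<longleftrightarrow>
    (\<forall>j::nat. \<exists>k::nat. \<forall>q::rat. of_rat q \<in> {\<rho>\<^sup>2 + 1 / (real j + 1)..\<rho>\<^sup>2 + real j + 2} \<longrightarrow>
       1 / (real k + 1) \<le> cmod (det (char_matrix (gram A) (of_real (of_rat q)))))"
proof -
  note G = gram_carrier[OF A]
  let ?f = "\<lambda>x. det (char_matrix (gram A) (complex_of_real x))"
  have "continuous_on S (\<lambda>x. if Q then complex_of_real x else 0)" for S Q
    by (cases Q) (auto intro!: continuous_intros)
  then have cont: "continuous_on S ?f" for S
    unfolding det_char_matrix[OF G] by (intro continuous_intros)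
  have "largest_singular_value A \<le> \<rho> \<longleftrightarrow> (\<forall>x>\<rho>\<^sup>2. ?f x \<noteq> 0)"
    unfolding largest_singular_value_le_iff[OF A m \<rho>] eigenvalue_det[OF G, symmetric]
  proof (intro iffI allI impI notI)
    fix x assume "\<forall>e. eigenvalue (gram A) e \<longrightarrow> Re e \<le> \<rho>\<^sup>2" "\<rho>\<^sup>2 < x" "eigenvalue (gram A) (of_real x)"
    then show False by fastforce
  next
    fix e assume *: "\<forall>x>\<rho>\<^sup>2. \<not> eigenvalue (gram A) (of_real x)" and e: "eigenvalue (gram A) e"
    have "eigenvalue (gram A) (of_real (Re e))"
      using eigenvalue_gram_real_nonneg(1)[OF A e] e by simp
    with * show "Re e \<le> \<rho>\<^sup>2" by (meson not_le)
  qed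
  also have "\<dots> \<longleftrightarrow> (\<forall>j::nat. \<forall>x\<in>{\<rho>\<^sup>2 + 1 / (real j + 1)..\<rho>\<^sup>2 + real j + 2}. ?f x \<noteq> 0)"
  proof (intro iffI allI ballI impI)
    fix x assume *: "\<forall>j::nat. \<forall>x\<in>{\<rho>\<^sup>2 + 1 / (real j + 1)..\<rho>\<^sup>2 + real j + 2}. ?f x \<noteq> 0" and x: "\<rho>\<^sup>2 < x"
    obtain j1 :: nat where j1: "inverse (real (Suc j1)) < x - \<rho>\<^sup>2"
      using reals_Archimedean[of "x - \<rho>\<^sup>2"] x by auto
    obtain j2 :: nat where j2: "x - \<rho>\<^sup>2 \<le> real j2" using real_arch_simple by blast
    define j where "j = max j1 j2"
    have "1 / (real j + 1) \<le> inverse (real (Suc j1))"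
      by (auto simp: j_def field_simps)
    moreover have "real j2 \<le> real j" by (simp add: j_def)
    ultimately have "x \<in> {\<rho>\<^sup>2 + 1 / (real j + 1)..\<rho>\<^sup>2 + real j + 2}"
      using j1 j2 by auto
    then show "?f x \<noteq> 0" using * by blast
  next
    fix j :: nat and x assume "\<forall>x>\<rho>\<^sup>2. ?f x \<noteq> 0" and "x \<in> {\<rho>\<^sup>2 + 1 / (real j + 1)..\<rho>\<^sup>2 + real j + 2}"
    moreover have "0 < 1 / (real j + 1)" by simp
    ultimately show "?f x \<noteq> 0" by (smt (verit) atLeastAtMost_iff)
  qed
  also have "\<dots> \<longleftrightarrow> (\<forall>j::nat. \<exists>k::nat. \<forall>q::rat.
      of_rat q \<in> {\<rho>\<^sup>2 + 1 / (real j + 1)..\<rho>\<^sup>2 + real j + 2} \<longrightarrow> 1 / (real k + 1) \<le> cmod (?f (of_rat q)))"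
  proof (intro arg_cong[where f = All] ext no_zero_on_interval_iff_rational cont)
    fix j :: nat
    have "1 / (real j + 1) \<le> 1" by simp
    then show "\<rho>\<^sup>2 + 1 / (real j + 1) < \<rho>\<^sup>2 + real j + 2" by linarith
  qed
  finally show ?thesis .
qed

lemma pred_largest_singular_value_le:
  assumes A: "measurable_mat M n m A" and m: "1 \<le> m" and \<rho>: "0 \<le> \<rho>"
  shows "Measurable.pred M (\<lambda>\<omega>. largest_singular_value (A \<omega>) \<le> \<rho>)"
proof -
  have carrier: "A \<omega> \<in> carrier_mat n m" if "\<omega> \<in> space M" for \<omega>
    using A that by (simp add: measurable_mat_def)
  have A_meas: "(\<lambda>\<omega>. A \<omega> $$ (a, b)) \<in> borel_measurable M" if "a < n" "b < m" for a b
    using A that by (simp add: measurable_mat_def)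
  have gram: "(\<lambda>\<omega>. gram (A \<omega>) $$ (i, j)) \<in> borel_measurable M" if "i < m" "j < m" for i j
  proof -
    have "cnj \<in> borel_measurable borel"
      by (intro borel_measurable_continuous_onI continuous_intros)
    then have "(\<lambda>\<omega>. cnj (A \<omega> $$ (a, i))) \<in> borel_measurable M" if "a < n" for a
      using A_meas[OF that \<open>i < m\<close>] by (rule measurable_compose[rotated])
    then have "(\<lambda>\<omega>. \<Sum>a<n. cnj (A \<omega> $$ (a, i)) * A \<omega> $$ (a, j)) \<in> borel_measurable M"
      using A_meas that by (intro borel_measurable_sum borel_measurable_times) auto
    then show ?thesis
      using that by (subst measurable_cong[OF index_gram[OF carrier]]) auto
  qed
  have det [measurable]: "(\<lambda>\<omega>. det (char_matrix (gram (A \<omega>)) e)) \<in> borel_measurable M" for e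
  proof -
    have "(\<lambda>\<omega>. \<Sum>p | p permutes {0..<m}. signof p *
        (\<Prod>i = 0..<m. gram (A \<omega>) $$ (i, p i) - (if i = p i then e else 0))) \<in> borel_measurable M"
    proof (intro borel_measurable_sum borel_measurable_times borel_measurable_prod borel_measurable_diff
        borel_measurable_const)
      fix p i assume "p \<in> {p. p permutes {0..<m}}" "i \<in> {0..<m}"
      then show "(\<lambda>\<omega>. gram (A \<omega>) $$ (i, p i)) \<in> borel_measurable M"
        using permutes_in_image[of p "{0..<m}" i] by (intro gram) auto
    qed
    then show ?thesis
      by (subst measurable_cong[OF det_char_matrix[OF gram_carrier[OF carrier]]]) auto
  qed
  show ?thesis
    by (subst measurable_cong[OF largest_singular_value_le_iff_rational[OF carrier m \<rho>]]) measurable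
qed

section \<open>Volumes that scale with a power of the radius\<close>

text \<open>
  The map \<open>h t\<close> is multiplication by \<open>t\<close> on the sample space, which need not be a vector space. The sets
  \<open>U e\<close> play the part of cubes; they are carried along to compare the unit ball of the spectral norm with
  a set from below and a set from above whose volumes are known to be positive and finite.
\<close>

definition scaling_volume ::
  "'a measure \<Rightarrow> (real \<Rightarrow> 'a \<Rightarrow> 'a) \<Rightarrow> (real \<Rightarrow> 'a set) \<Rightarrow> nat \<Rightarrow> bool" where
  "scaling_volume V h U d \<longleftrightarrow> sigma_finite_measure V \<and>
     (\<forall>t>0. h t \<in> measurable V V \<and>
        (\<forall>S\<in>sets V. emeasure V S = ennreal (t ^ d) * emeasure V (h t -` S \<inter> space V))) \<and>
     (\<forall>e>0. U e \<in> sets V \<and> 0 < emeasure V (U e) \<and> emeasure V (U e) < \<infinity>)"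

lemma scaling_volumeD:
  assumes "scaling_volume V h U d"
  shows "sigma_finite_measure V"
    and "0 < t \<Longrightarrow> h t \<in> measurable V V"
    and "0 < t \<Longrightarrow> S \<in> sets V \<Longrightarrow> emeasure V S = ennreal (t ^ d) * emeasure V (h t -` S \<inter> space V)"
    and "0 < e \<Longrightarrow> U e \<in> sets V" "0 < e \<Longrightarrow> 0 < emeasure V (U e)" "0 < e \<Longrightarrow> emeasure V (U e) < \<infinity>"
  using assms unfolding scaling_volume_def by blast+

lemma scaling_volume_lborel:
  "scaling_volume (lborel :: 'a::euclidean_space measure) (\<lambda>t x. t *\<^sub>R x) (\<lambda>e. cball 0 e) DIM('a)"
  unfolding scaling_volume_def
proof (intro conjI allI impI ballI)
  show "sigma_finite_measure (lborel :: 'a measure)" by (rule lborel.sigma_finite_measure_axioms)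
  fix t :: real assume t: "0 < t"
  show "(\<lambda>x. t *\<^sub>R x) \<in> measurable (lborel :: 'a measure) lborel" by simp
  show "emeasure lborel S = ennreal (t ^ DIM('a)) * emeasure lborel ((\<lambda>x::'a. t *\<^sub>R x) -` S \<inter> space lborel)"
    if "S \<in> sets lborel" for S
    using emeasure_lborel_affine_vimage[OF t, of S 0] that by simp
next
  fix e :: real assume e: "0 < e"
  show "cball 0 e \<in> sets (lborel :: 'a measure)" by simp
  show "0 < emeasure lborel (cball (0::'a) e)"
    using content_cball_pos[OF e, of "0::'a"] by (simp add: measure_def enn2real_positive_iff)
  show "emeasure lborel (cball (0::'a) e) < \<infinity>"
    using emeasure_compact_finite[of "cball (0::'a) e"] by simp
qed

lemma sigma_finite_embed_measure_inj_on:
  assumes V: "sigma_finite_measure V" and f: "inj_on f (space V)"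
  shows "sigma_finite_measure (embed_measure V f)"
proof -
  obtain A where A: "countable A" "A \<subseteq> sets V" "\<Union>A = space V" "\<forall>a\<in>A. emeasure V a \<noteq> \<infinity>"
    using V unfolding sigma_finite_measure_def by blast
  show ?thesis
  proof
    show "\<exists>A'. countable A' \<and> A' \<subseteq> sets (embed_measure V f) \<and> \<Union>A' = space (embed_measure V f) \<and>
        (\<forall>a\<in>A'. emeasure (embed_measure V f) a \<noteq> \<infinity>)"
    proof (intro exI[of _ "(`) f ` A"] conjI)
      show "countable ((`) f ` A)" using A(1) by simp
      show "(`) f ` A \<subseteq> sets (embed_measure V f)" using A(2) by (auto intro: in_sets_embed_measure)
      show "\<Union>((`) f ` A) = space (embed_measure V f)"
        unfolding space_embed_measure A(3)[symmetric] by blast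
      show "\<forall>a\<in>(`) f ` A. emeasure (embed_measure V f) a \<noteq> \<infinity>"
        using A(2,4) by (auto simp: emeasure_embed_measure_image'[OF f] subset_iff)
    qed
  qed
qed

lemma scaling_volume_embed_measure:
  assumes V: "scaling_volume V h U d" and f: "inj_on f (space V)"
    and h': "\<And>t x. 0 < t \<Longrightarrow> x \<in> space V \<Longrightarrow> h' t (f x) = f (h t x)"
  shows "scaling_volume (embed_measure V f) h' (\<lambda>e. f ` U e) d"
  unfolding scaling_volume_def
proof (intro conjI allI impI ballI)
  note V = scaling_volumeD[OF V]
  show "sigma_finite_measure (embed_measure V f)"
    using V(1) f by (rule sigma_finite_embed_measure_inj_on)
  fix t :: real assume t: "0 < t"
  have "(\<lambda>x. f (h t x)) \<in> measurable V (embed_measure V f)"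
    using V(2)[OF t] measurable_embed_measure2'[OF f] by (rule measurable_compose)
  then have "(\<lambda>x. h' t (f x)) \<in> measurable V (embed_measure V f)"
    by (subst measurable_cong[OF h'[OF t]])
  then show "h' t \<in> measurable (embed_measure V f) (embed_measure V f)"
    by (rule measurable_embed_measure1)
  fix S assume "S \<in> sets (embed_measure V f)"
  then obtain A where A: "A \<in> sets V" "S = f ` A" by (auto simp: sets_embed_measure'[OF f])
  have h_space: "h t x \<in> space V" if "x \<in> space V" for x
    using measurable_space[OF V(2)[OF t] that] .
  have inj: "f x \<in> f ` A \<longleftrightarrow> x \<in> A" if "x \<in> space V" for x
    using f that sets.sets_into_space[OF A(1)] by (auto dest: inj_onD)
  have "h' t -` S \<inter> space (embed_measure V f) = f ` (h t -` A \<inter> space V)"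
  proof -
    have "h' t (f x) \<in> S \<longleftrightarrow> h t x \<in> A" if "x \<in> space V" for x
      unfolding h'[OF t that] A(2) by (rule inj[OF h_space[OF that]])
    then show ?thesis unfolding space_embed_measure by blast
  qed
  moreover have "h t -` A \<inter> space V \<in> sets V"
    using V(2)[OF t] A(1) by (rule measurable_sets)
  ultimately show "emeasure (embed_measure V f) S =
      ennreal (t ^ d) * emeasure (embed_measure V f) (h' t -` S \<inter> space (embed_measure V f))"
    using V(3)[OF t A(1)] A by (simp add: emeasure_embed_measure_image'[OF f])
next
  note V = scaling_volumeD[OF V]
  fix e :: real assume e: "0 < e"
  show "f ` U e \<in> sets (embed_measure V f)" using V(4)[OF e] by (rule in_sets_embed_measure)
  show "0 < emeasure (embed_measure V f) (f ` U e)" "emeasure (embed_measure V f) (f ` U e) < \<infinity>"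
    using V(4-6)[OF e] by (simp_all add: emeasure_embed_measure_image'[OF f])
qed

text \<open>
  By uniqueness of product measures it suffices to compare the product with the rescaled image of the product
  on rectangles, where both are products of the factors.
\<close>

lemma scaling_volume_PiM:
  assumes V: "\<And>i. scaling_volume (V i) (h i) (U i) (d i)" and I: "finite I"
  shows "scaling_volume (PiM I V) (\<lambda>t x. \<lambda>i\<in>I. h i t (x i)) (\<lambda>e. PiE I (\<lambda>i. U i e)) (\<Sum>i\<in>I. d i)"
  unfolding scaling_volume_def
proof (intro conjI allI impI ballI)
  note V = scaling_volumeD[OF V]
  interpret product_sigma_finite V
    by (rule product_sigma_finite.intro) (rule V(1))
  show "sigma_finite_measure (PiM I V)" using I by (rule sigma_finite)
  fix t :: real assume t: "0 < t"
  let ?h = "\<lambda>x. \<lambda>i\<in>I. h i t (x i)"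
  show h: "?h \<in> measurable (PiM I V) (PiM I V)"
  proof (rule measurable_restrict)
    fix i assume "i \<in> I"
    then have "(\<lambda>x. x i) \<in> measurable (PiM I V) (V i)" by (rule measurable_component_singleton)
    then show "(\<lambda>x. h i t (x i)) \<in> measurable (PiM I V) (V i)"
      using V(2)[OF t] by (rule measurable_compose)
  qed
  have "scale_measure (ennreal (t ^ (\<Sum>i\<in>I. d i))) (distr (PiM I V) (PiM I V) ?h) = PiM I V"
  proof (rule PiM_eqI[OF I])
    fix A assume A: "\<And>i. i \<in> I \<Longrightarrow> A i \<in> sets (V i)"
    have vimage_sets: "h i t -` A i \<inter> space (V i) \<in> sets (V i)" if "i \<in> I" for i
      using V(2)[OF t] A[OF that] by (rule measurable_sets)
    have "?h -` Pi\<^sub>E I A \<inter> space (PiM I V) = (\<Pi>\<^sub>E i\<in>I. h i t -` A i \<inter> space (V i))"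
      by (auto simp: space_PiM PiE_iff)
    then have "emeasure (distr (PiM I V) (PiM I V) ?h) (Pi\<^sub>E I A) =
        (\<Prod>i\<in>I. emeasure (V i) (h i t -` A i \<inter> space (V i)))"
      using h A I vimage_sets by (simp add: emeasure_distr sets_PiM_I_finite emeasure_PiM)
    moreover have "(\<Prod>i\<in>I. emeasure (V i) (A i)) =
        (\<Prod>i\<in>I. ennreal (t ^ d i)) * (\<Prod>i\<in>I. emeasure (V i) (h i t -` A i \<inter> space (V i)))"
      using V(3)[OF t A] by (simp add: prod.distrib)
    moreover have "(\<Prod>i\<in>I. ennreal (t ^ d i)) = ennreal (t ^ (\<Sum>i\<in>I. d i))"
      using t by (simp add: prod_ennreal power_sum)
    ultimately show "emeasure (scale_measure (ennreal (t ^ (\<Sum>i\<in>I. d i))) (distr (PiM I V) (PiM I V) ?h)) (Pi\<^sub>E I A) =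
        (\<Prod>i\<in>I. emeasure (V i) (A i))" by simp
  qed simp
  then show "emeasure (PiM I V) S =
      ennreal (t ^ (\<Sum>i\<in>I. d i)) * emeasure (PiM I V) (?h -` S \<inter> space (PiM I V))"
    if "S \<in> sets (PiM I V)" for S
    using emeasure_distr[OF h that] by (metis emeasure_scale_measure)
next
  note V = scaling_volumeD[OF V]
  interpret product_sigma_finite V
    by (rule product_sigma_finite.intro) (rule V(1))
  fix e :: real assume e: "0 < e"
  show "(\<Pi>\<^sub>E i\<in>I. U i e) \<in> sets (PiM I V)"
    using I V(4)[OF e] by (intro sets_PiM_I_finite) auto
  have eq: "emeasure (PiM I V) (\<Pi>\<^sub>E i\<in>I. U i e) = (\<Prod>i\<in>I. emeasure (V i) (U i e))"
    using I V(4)[OF e] by (intro emeasure_PiM) auto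
  show "0 < emeasure (PiM I V) (\<Pi>\<^sub>E i\<in>I. U i e)"
    unfolding eq using V(5)[OF e] I by (auto simp: zero_less_iff_neq_zero)
  show "emeasure (PiM I V) (\<Pi>\<^sub>E i\<in>I. U i e) < \<infinity>"
    unfolding eq using V(6)[OF e] by (auto simp: ennreal_prod_eq_top less_top[symmetric])
qed

lemma scaling_volume_pair_measure:
  assumes V: "scaling_volume V h U d" and V': "scaling_volume V' h' U' d'"
  shows "scaling_volume (V \<Otimes>\<^sub>M V') (\<lambda>t (x, y). (h t x, h' t y)) (\<lambda>e. U e \<times> U' e) (d + d')"
  unfolding scaling_volume_def
proof (intro conjI allI impI ballI)
  note V = scaling_volumeD[OF V] and V' = scaling_volumeD[OF V']
  interpret V: sigma_finite_measure V by (rule V(1))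
  interpret V': sigma_finite_measure V' by (rule V'(1))
  interpret pair_sigma_finite V V' ..
  show "sigma_finite_measure (V \<Otimes>\<^sub>M V')" by (rule sigma_finite_measure_axioms)
  fix t :: real assume t: "0 < t"
  note [measurable] = V(2)[OF t] V'(2)[OF t]
  let ?h = "\<lambda>(x, y). (h t x, h' t y)"
  show h: "?h \<in> measurable (V \<Otimes>\<^sub>M V') (V \<Otimes>\<^sub>M V')" by measurable
  have "V \<Otimes>\<^sub>M V' = scale_measure (ennreal (t ^ (d + d'))) (distr (V \<Otimes>\<^sub>M V') (V \<Otimes>\<^sub>M V') ?h)"
  proof (rule pair_measure_eqI[OF V(1) V'(1)])
    fix A B assume A: "A \<in> sets V" and B: "B \<in> sets V'"
    have "?h -` (A \<times> B) \<inter> space (V \<Otimes>\<^sub>M V') = (h t -` A \<inter> space V) \<times> (h' t -` B \<inter> space V')"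
      by (auto simp: space_pair_measure)
    then have "emeasure (distr (V \<Otimes>\<^sub>M V') (V \<Otimes>\<^sub>M V') ?h) (A \<times> B) =
        emeasure V (h t -` A \<inter> space V) * emeasure V' (h' t -` B \<inter> space V')"
      using A B h measurable_sets[OF V(2)[OF t] A] measurable_sets[OF V'(2)[OF t] B]
      by (simp add: emeasure_distr V'.emeasure_pair_measure_Times)
    then show "emeasure V A * emeasure V' B =
        emeasure (scale_measure (ennreal (t ^ (d + d'))) (distr (V \<Otimes>\<^sub>M V') (V \<Otimes>\<^sub>M V') ?h)) (A \<times> B)"
      using V(3)[OF t A] V'(3)[OF t B] t by (simp add: power_add ennreal_mult ac_simps)
  qed simp
  then show "emeasure (V \<Otimes>\<^sub>M V') S =
      ennreal (t ^ (d + d')) * emeasure (V \<Otimes>\<^sub>M V') (?h -` S \<inter> space (V \<Otimes>\<^sub>M V'))"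
    if "S \<in> sets (V \<Otimes>\<^sub>M V')" for S
    using emeasure_distr[OF h that] by (metis emeasure_scale_measure)
next
  note V = scaling_volumeD[OF V] and V' = scaling_volumeD[OF V']
  interpret V': sigma_finite_measure V' by (rule V'(1))
  fix e :: real assume e: "0 < e"
  show "U e \<times> U' e \<in> sets (V \<Otimes>\<^sub>M V')" using V(4)[OF e] V'(4)[OF e] by simp
  have eq: "emeasure (V \<Otimes>\<^sub>M V') (U e \<times> U' e) = emeasure V (U e) * emeasure V' (U' e)"
    using V(4)[OF e] V'(4)[OF e] by (rule V'.emeasure_pair_measure_Times)
  show "0 < emeasure (V \<Otimes>\<^sub>M V') (U e \<times> U' e)"
    unfolding eq using V(5)[OF e] V'(5)[OF e] by (simp add: ennreal_zero_less_mult_iff)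
  show "emeasure (V \<Otimes>\<^sub>M V') (U e \<times> U' e) < \<infinity>"
    unfolding eq using V(6)[OF e] V'(6)[OF e] by (simp add: ennreal_mult_less_top)
qed

section \<open>The volume on block-diagonal matrices\<close>

lemma scalar_vol_space: "space (scalar_vol F) = scalars F"
  by (cases F) (auto simp: space_embed_measure Reals_def)

lemma measurable_scalar_vol_borel: "(\<lambda>z. z) \<in> borel_measurable (scalar_vol F)"
proof (cases F)
  case Real_Field
  have "(\<lambda>x. complex_of_real x) \<in> borel_measurable lborel" by simp
  then show ?thesis using Real_Field by (auto intro: measurable_embed_measure1)
qed simp

definition scalar_disc :: "scalar_field \<Rightarrow> real \<Rightarrow> complex set" where
  "scalar_disc F e = {z \<in> scalars F. cmod z \<le> e}"

lemma scaling_volume_scalar_vol: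
  "scaling_volume (scalar_vol F) (\<lambda>t z. of_real t * z) (scalar_disc F) (variable_dim F 1 1)"
proof (cases F)
  case Real_Field
  have "scaling_volume (embed_measure lborel complex_of_real) (\<lambda>t z. of_real t * z)
      (\<lambda>e. complex_of_real ` cball 0 e) DIM(real)"
    by (intro scaling_volume_embed_measure[OF scaling_volume_lborel]) (auto simp: inj_on_def)
  moreover have "complex_of_real ` cball 0 e = scalar_disc Real_Field e" for e
    by (force simp: scalar_disc_def Reals_def)
  ultimately show ?thesis using Real_Field by simp
next
  case Complex_Field
  have "cball 0 e = scalar_disc Complex_Field e" for e
    by (auto simp: scalar_disc_def)
  moreover have "(\<lambda>t z. t *\<^sub>R z) = (\<lambda>t z. complex_of_real t * z)"
    by (simp add: scaleR_conv_of_real fun_eq_iff)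
  ultimately show ?thesis
    using scaling_volume_lborel[where ?'a = complex] Complex_Field by simp
qed

definition matrix_entries :: "scalar_field \<Rightarrow> nat \<Rightarrow> nat \<Rightarrow> (nat \<times> nat \<Rightarrow> complex) measure" where
  "matrix_entries F n m = (\<Pi>\<^sub>M ab\<in>{..<n} \<times> {..<m}. scalar_vol F)"

lemma matrix_vol_eq: "matrix_vol F n m = embed_measure (matrix_entries F n m) (\<lambda>x. mat n m x)"
  by (simp add: matrix_vol_def matrix_entries_def)

lemma inj_on_mat: "inj_on (\<lambda>x. mat n m x) (space (matrix_entries F n m))"
proof (rule inj_onI)
  fix x y assume x: "x \<in> space (matrix_entries F n m)" and y: "y \<in> space (matrix_entries F n m)"
    and eq: "mat n m x = mat n m y"
  show "x = y"
  proof (rule PiE_ext)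
    show "x \<in> ({..<n} \<times> {..<m}) \<rightarrow>\<^sub>E scalars F" "y \<in> ({..<n} \<times> {..<m}) \<rightarrow>\<^sub>E scalars F"
      using x y by (auto simp: matrix_entries_def space_PiM scalar_vol_space)
    fix p assume "p \<in> {..<n} \<times> {..<m}"
    then show "x p = y p" using arg_cong[OF eq, of "\<lambda>A. A $$ p"] by (cases p) simp
  qed
qed

lemma matrix_vol_space:
  "space (matrix_vol F n m) = {A \<in> carrier_mat n m. \<forall>a<n. \<forall>b<m. A $$ (a, b) \<in> scalars F}"
proof (rule Set.set_eqI, rule iffI)
  fix A assume "A \<in> space (matrix_vol F n m)"
  then obtain x where A: "A = mat n m x" and x: "x \<in> ({..<n} \<times> {..<m}) \<rightarrow>\<^sub>E scalars F"
    unfolding matrix_vol_eq space_embed_measure matrix_entries_def space_PiM scalar_vol_space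
    by (rule imageE)
  have "x (a, b) \<in> scalars F" if "a < n" "b < m" for a b
    using x by (rule PiE_mem) (use that in simp)
  then show "A \<in> {A \<in> carrier_mat n m. \<forall>a<n. \<forall>b<m. A $$ (a, b) \<in> scalars F}"
    by (simp add: A)
next
  fix A assume A: "A \<in> {A \<in> carrier_mat n m. \<forall>a<n. \<forall>b<m. A $$ (a, b) \<in> scalars F}"
  define x where "x = (\<lambda>p\<in>{..<n} \<times> {..<m}. A $$ p)"
  have "A = mat n m x" using A by (intro eq_matI) (auto simp: x_def)
  moreover have "x \<in> space (matrix_entries F n m)"
    using A by (auto simp: x_def matrix_entries_def space_PiM scalar_vol_space)
  ultimately show "A \<in> space (matrix_vol F n m)"
    unfolding matrix_vol_eq space_embed_measure by (rule image_eqI)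
qed

lemma measurable_entry_matrix_vol:
  assumes "a < n" "b < m"
  shows "(\<lambda>A. A $$ (a, b)) \<in> borel_measurable (matrix_vol F n m)"
proof -
  have "(\<lambda>x. x (a, b)) \<in> measurable (matrix_entries F n m) (scalar_vol F)"
    unfolding matrix_entries_def using assms by (intro measurable_component_singleton) auto
  then have "(\<lambda>x. x (a, b)) \<in> borel_measurable (matrix_entries F n m)"
    using measurable_scalar_vol_borel by (rule measurable_compose)
  then show ?thesis
    unfolding matrix_vol_eq using assms by (intro measurable_embed_measure1) simp
qed

definition matrix_box :: "scalar_field \<Rightarrow> nat \<Rightarrow> nat \<Rightarrow> real \<Rightarrow> complex mat set" where
  "matrix_box F n m e = (\<lambda>x. mat n m x) ` (({..<n} \<times> {..<m}) \<rightarrow>\<^sub>E scalar_disc F e)"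

lemma matrix_box_eq:
  "matrix_box F n m e =
     {A \<in> carrier_mat n m. \<forall>a<n. \<forall>b<m. A $$ (a, b) \<in> scalars F \<and> cmod (A $$ (a, b)) \<le> e}"
proof (rule Set.set_eqI, rule iffI)
  fix A assume "A \<in> matrix_box F n m e"
  then obtain x where A: "A = mat n m x" and x: "x \<in> ({..<n} \<times> {..<m}) \<rightarrow>\<^sub>E scalar_disc F e"
    unfolding matrix_box_def by (rule imageE)
  have "x (a, b) \<in> scalar_disc F e" if "a < n" "b < m" for a b
    using x by (rule PiE_mem) (use that in simp)
  then show "A \<in> {A \<in> carrier_mat n m. \<forall>a<n. \<forall>b<m. A $$ (a, b) \<in> scalars F \<and> cmod (A $$ (a, b)) \<le> e}"
    by (simp add: A scalar_disc_def)
next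
  fix A assume A: "A \<in> {A \<in> carrier_mat n m. \<forall>a<n. \<forall>b<m. A $$ (a, b) \<in> scalars F \<and> cmod (A $$ (a, b)) \<le> e}"
  define x where "x = (\<lambda>p\<in>{..<n} \<times> {..<m}. A $$ p)"
  have "A = mat n m x" using A by (intro eq_matI) (auto simp: x_def)
  moreover have "x \<in> ({..<n} \<times> {..<m}) \<rightarrow>\<^sub>E scalar_disc F e"
    using A by (auto simp: x_def scalar_disc_def)
  ultimately show "A \<in> matrix_box F n m e"
    unfolding matrix_box_def by (rule image_eqI)
qed

lemma scaling_volume_matrix_vol:
  "scaling_volume (matrix_vol F n m) (\<lambda>t A. of_real t \<cdot>\<^sub>m A) (matrix_box F n m) (variable_dim F n m)"
proof -
  have "scaling_volume (matrix_entries F n m)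
      (\<lambda>t x. \<lambda>p\<in>{..<n} \<times> {..<m}. of_real t * x p) (\<lambda>e. ({..<n} \<times> {..<m}) \<rightarrow>\<^sub>E scalar_disc F e)
      (\<Sum>p\<in>{..<n} \<times> {..<m}. variable_dim F 1 1)"
    unfolding matrix_entries_def by (intro scaling_volume_PiM scaling_volume_scalar_vol) simp
  then have "scaling_volume (embed_measure (matrix_entries F n m) (\<lambda>x. mat n m x))
      (\<lambda>t A. of_real t \<cdot>\<^sub>m A) (\<lambda>e. (\<lambda>x. mat n m x) ` (({..<n} \<times> {..<m}) \<rightarrow>\<^sub>E scalar_disc F e))
      (\<Sum>p\<in>{..<n} \<times> {..<m}. variable_dim F 1 1)"
    by (rule scaling_volume_embed_measure[OF _ inj_on_mat]) (auto intro!: eq_matI)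
  moreover have "(\<Sum>p\<in>{..<n} \<times> {..<m}. variable_dim F 1 1) = variable_dim F n m"
    by (cases F) (simp_all add: card_cartesian_product)
  ultimately show ?thesis
    by (simp add: matrix_vol_eq matrix_box_def[abs_def])
qed

subsection \<open>Block-diagonal matrices as a function of their blocks\<close>

lemma four_block_diag_inj:
  assumes "dim_row A = dim_row A'" "dim_col A = dim_col A'" "dim_row C = dim_row C'" "dim_col C = dim_col C'"
    and eq: "four_block_mat A (0\<^sub>m (dim_row A) (dim_col C)) (0\<^sub>m (dim_row C) (dim_col A)) C =
      four_block_mat A' (0\<^sub>m (dim_row A') (dim_col C')) (0\<^sub>m (dim_row C') (dim_col A')) C'"
  shows "A = A'" "C = C'"
proof -
  show "A = A'"
  proof (rule eq_matI)
    fix i j assume "i < dim_row A'" "j < dim_col A'"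
    then show "A $$ (i, j) = A' $$ (i, j)"
      using arg_cong[OF eq, of "\<lambda>M. M $$ (i, j)"] assms(1-4) by simp
  qed (use assms in auto)
  show "C = C'"
  proof (rule eq_matI)
    fix i j assume "i < dim_row C'" "j < dim_col C'"
    then show "C $$ (i, j) = C' $$ (i, j)"
      using arg_cong[OF eq, of "\<lambda>M. M $$ (dim_row A' + i, dim_col A' + j)"] assms(1-4) by simp
  qed (use assms in auto)
qed

text \<open>
  The positions of the blocks are determined by their dimensions, so a block-diagonal matrix with known
  block dimensions determines its blocks.
\<close>

lemma diag_block_mat_inj:
  assumes "map dim_row As = map dim_row Bs" "map dim_col As = map dim_col Bs"
    and "diag_block_mat As = diag_block_mat Bs"
  shows "As = Bs"
  using assms
proof (induction As arbitrary: Bs)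
  case (Cons A As)
  then obtain B Bs' where Bs: "Bs = B # Bs'" by (cases Bs) auto
  have "dim_row (diag_block_mat As) = dim_row (diag_block_mat Bs')"
    "dim_col (diag_block_mat As) = dim_col (diag_block_mat Bs')"
    using Cons.prems by (auto simp: Bs dim_diag_block_mat)
  then have "A = B" "diag_block_mat As = diag_block_mat Bs'"
    using Cons.prems four_block_diag_inj[of A B "diag_block_mat As" "diag_block_mat Bs'"]
    by (simp_all add: Bs Let_def)
  then show ?case using Cons Bs by auto
qed simp

lemma diag_block_mat_contains_entry:
  assumes "D \<in> set Ds" "a < dim_row D" "b < dim_col D"
  shows "\<exists>i<dim_row (diag_block_mat Ds). \<exists>j<dim_col (diag_block_mat Ds). diag_block_mat Ds $$ (i, j) = D $$ (a, b)"
  using assms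
proof (induction Ds)
  case (Cons A Ds)
  show ?case
  proof (cases "D = A")
    case True
    then show ?thesis using Cons.prems
      by (intro exI[of _ a] conjI exI[of _ b]) (auto simp: Let_def)
  next
    case False
    then obtain i j where "i < dim_row (diag_block_mat Ds)" "j < dim_col (diag_block_mat Ds)"
      "diag_block_mat Ds $$ (i, j) = D $$ (a, b)" using Cons by auto
    then show ?thesis
      by (intro exI[of _ "dim_row A + i"] conjI exI[of _ "dim_col A + j"]) (auto simp: Let_def)
  qed
qed simp

lemma smult_diag_block_mat:
  fixes c :: "'a::comm_ring_1"
  shows "c \<cdot>\<^sub>m diag_block_mat Ds = diag_block_mat (map (\<lambda>D. c \<cdot>\<^sub>m D) Ds)"
proof (induction Ds)
  case (Cons A Ds)
  have "c \<cdot>\<^sub>m diag_block_mat (A # Ds) = four_block_mat (c \<cdot>\<^sub>m A)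
      (0\<^sub>m (dim_row A) (dim_col (diag_block_mat Ds))) (0\<^sub>m (dim_row (diag_block_mat Ds)) (dim_col A))
      (c \<cdot>\<^sub>m diag_block_mat Ds)"
    by (intro eq_matI) (auto simp: Let_def)
  also have "\<dots> = diag_block_mat (map (\<lambda>D. c \<cdot>\<^sub>m D) (A # Ds))"
    by (simp add: Let_def Cons[symmetric])
  finally show ?case .
qed (auto intro: eq_matI)

lemma measurable_mat_diag_block_mat:
  assumes "\<And>k. k \<in> set ks \<Longrightarrow> measurable_mat M (nr k) (nc k) (f k)"
  shows "measurable_mat M (\<Sum>k\<leftarrow>ks. nr k) (\<Sum>k\<leftarrow>ks. nc k) (\<lambda>\<omega>. diag_block_mat (map (\<lambda>k. f k \<omega>) ks))"
  using assms
proof (induction ks)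
  case Nil
  then show ?case by (simp add: measurable_mat_def)
next
  case (Cons k ks)
  define D where "D = (\<lambda>\<omega>. diag_block_mat (map (\<lambda>k. f k \<omega>) ks))"
  define r c where "r = (\<Sum>k\<leftarrow>ks. nr k)" and "c = (\<Sum>k\<leftarrow>ks. nc k)"
  have f: "\<And>\<omega>. \<omega> \<in> space M \<Longrightarrow> f k \<omega> \<in> carrier_mat (nr k) (nc k)"
    "\<And>a b. a < nr k \<Longrightarrow> b < nc k \<Longrightarrow> (\<lambda>\<omega>. f k \<omega> $$ (a, b)) \<in> borel_measurable M"
    using Cons.prems[of k] by (auto simp: measurable_mat_def)
  have D: "\<And>\<omega>. \<omega> \<in> space M \<Longrightarrow> D \<omega> \<in> carrier_mat r c"
    "\<And>a b. a < r \<Longrightarrow> b < c \<Longrightarrow> (\<lambda>\<omega>. D \<omega> $$ (a, b)) \<in> borel_measurable M"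
    using Cons by (auto simp: measurable_mat_def D_def r_def c_def)
  have Cons_eq: "diag_block_mat (map (\<lambda>k. f k \<omega>) (k # ks)) = four_block_mat (f k \<omega>)
      (0\<^sub>m (dim_row (f k \<omega>)) (dim_col (D \<omega>))) (0\<^sub>m (dim_row (D \<omega>)) (dim_col (f k \<omega>))) (D \<omega>)" for \<omega>
    by (simp add: Let_def D_def)
  have entry: "diag_block_mat (map (\<lambda>k. f k \<omega>) (k # ks)) $$ (a, b) =
      (if a < nr k then if b < nc k then f k \<omega> $$ (a, b) else 0
       else if b < nc k then 0 else D \<omega> $$ (a - nr k, b - nc k))"
    if "\<omega> \<in> space M" "a < nr k + r" "b < nc k + c" for \<omega> a b
    using f(1)[OF that(1)] D(1)[OF that(1)] that(2,3) unfolding Cons_eq by auto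
  show ?case
    unfolding measurable_mat_def
  proof (intro conjI ballI allI impI)
    show "diag_block_mat (map (\<lambda>k. f k \<omega>) (k # ks)) \<in> carrier_mat (\<Sum>k\<leftarrow>k # ks. nr k) (\<Sum>k\<leftarrow>k # ks. nc k)"
      if "\<omega> \<in> space M" for \<omega>
      using f(1)[OF that] D(1)[OF that] unfolding Cons_eq by (auto simp: r_def c_def)
    fix a b assume "a < (\<Sum>k\<leftarrow>k # ks. nr k)" "b < (\<Sum>k\<leftarrow>k # ks. nc k)"
    then have ab: "a < nr k + r" "b < nc k + c" by (auto simp: r_def c_def)
    have "(\<lambda>\<omega>. if a < nr k then if b < nc k then f k \<omega> $$ (a, b) else 0
       else if b < nc k then 0 else D \<omega> $$ (a - nr k, b - nc k)) \<in> borel_measurable M"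
      using ab by (cases "a < nr k"; cases "b < nc k") (auto intro!: f(2) D(2))
    then show "(\<lambda>\<omega>. diag_block_mat (map (\<lambda>k. f k \<omega>) (k # ks)) $$ (a, b)) \<in> borel_measurable M"
      by (subst measurable_cong[OF entry[OF _ ab]]) auto
  qed
qed

definition full_block_vol :: "scalar_field \<times> nat \<times> nat \<Rightarrow> complex mat measure" where
  "full_block_vol = (\<lambda>(F, n, m). matrix_vol F n m)"

definition block_params ::
  "scalar_blocks \<Rightarrow> full_blocks \<Rightarrow> ((nat \<Rightarrow> complex) \<times> (nat \<Rightarrow> complex mat)) measure" where
  "block_params sb fb =
     (\<Pi>\<^sub>M i\<in>{..<length sb}. scalar_vol (fst (sb ! i))) \<Otimes>\<^sub>M
     (\<Pi>\<^sub>M j\<in>{..<length fb}. full_block_vol (fb ! j))"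

definition block_box ::
  "scalar_blocks \<Rightarrow> full_blocks \<Rightarrow> real \<Rightarrow> ((nat \<Rightarrow> complex) \<times> (nat \<Rightarrow> complex mat)) set" where
  "block_box sb fb e =
     (\<Pi>\<^sub>E i\<in>{..<length sb}. scalar_disc (fst (sb ! i)) e) \<times>
     (\<Pi>\<^sub>E j\<in>{..<length fb}. case fb ! j of (F, n, m) \<Rightarrow> matrix_box F n m e)"

definition block_rows :: "scalar_blocks \<Rightarrow> full_blocks \<Rightarrow> nat" where
  "block_rows sb fb = (\<Sum>i\<leftarrow>[0..<length sb]. snd (sb ! i)) + (\<Sum>j\<leftarrow>[0..<length fb]. fst (snd (fb ! j)))"

definition block_cols :: "scalar_blocks \<Rightarrow> full_blocks \<Rightarrow> nat" where
  "block_cols sb fb = (\<Sum>i\<leftarrow>[0..<length sb]. snd (sb ! i)) + (\<Sum>j\<leftarrow>[0..<length fb]. snd (snd (fb ! j)))"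

abbreviation block_list ::
  "scalar_blocks \<Rightarrow> full_blocks \<Rightarrow> (nat \<Rightarrow> complex) \<Rightarrow> (nat \<Rightarrow> complex mat) \<Rightarrow> complex mat list" where
  "block_list sb fb q D \<equiv>
     map (\<lambda>i. q i \<cdot>\<^sub>m 1\<^sub>m (snd (sb ! i))) [0..<length sb] @ map D [0..<length fb]"

lemma block_vol_eq: "block_vol sb fb = embed_measure (block_params sb fb) (block_diag sb fb)"
  by (simp add: block_vol_def block_params_def full_block_vol_def)

lemma full_block_vol_space:
  "space (full_block_vol b) = {A \<in> carrier_mat (fst (snd b)) (snd (snd b)).
     \<forall>x<fst (snd b). \<forall>y<snd (snd b). A $$ (x, y) \<in> scalars (fst b)}"
  by (cases b) (simp add: full_block_vol_def matrix_vol_space)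

lemma block_params_space:
  "space (block_params sb fb) =
     (\<Pi>\<^sub>E i\<in>{..<length sb}. scalars (fst (sb ! i))) \<times>
     (\<Pi>\<^sub>E j\<in>{..<length fb}. space (full_block_vol (fb ! j)))"
  by (simp add: block_params_def space_pair_measure space_PiM scalar_vol_space)

lemma block_params_full_block_carrier:
  assumes "(q, D) \<in> space (block_params sb fb)" "j < length fb"
  shows "D j \<in> carrier_mat (fst (snd (fb ! j))) (snd (snd (fb ! j)))"
  using assms PiE_mem[of D "{..<length fb}" "\<lambda>j. space (full_block_vol (fb ! j))" j]
  by (auto simp: block_params_space full_block_vol_space)

lemmas block_params_full_block_dims = block_params_full_block_carrier[THEN carrier_matD(1)]
  block_params_full_block_carrier[THEN carrier_matD(2)]

lemma block_diag_carrier: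
  assumes "(q, D) \<in> space (block_params sb fb)"
  shows "block_diag sb fb (q, D) \<in> carrier_mat (block_rows sb fb) (block_cols sb fb)"
proof -
  have dims: "map dim_row (map D [0..<length fb]) = map (\<lambda>j. fst (snd (fb ! j))) [0..<length fb]"
    "map dim_col (map D [0..<length fb]) = map (\<lambda>j. snd (snd (fb ! j))) [0..<length fb]"
    using block_params_full_block_dims[OF assms] by auto
  have "dim_row (block_diag sb fb (q, D)) = block_rows sb fb"
    "dim_col (block_diag sb fb (q, D)) = block_cols sb fb"
    unfolding block_diag_def case_prod_conv dim_diag_block_mat map_append dims sum_list_append
      block_rows_def block_cols_def by (simp_all add: comp_def)
  then show ?thesis by auto
qed

lemma wf_blocks_multiplicity: "wf_blocks sb fb \<Longrightarrow> i < length sb \<Longrightarrow> 1 \<le> snd (sb ! i)"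
  unfolding wf_blocks_def by (metis (no_types, lifting) case_prodD nth_mem prod.collapse)

lemma wf_blocks_size:
  "wf_blocks sb fb \<Longrightarrow> j < length fb \<Longrightarrow> 1 \<le> fst (snd (fb ! j)) \<and> 1 \<le> snd (snd (fb ! j))"
  unfolding wf_blocks_def by (metis (no_types, lifting) case_prodD nth_mem prod.collapse)

text \<open>
  A scalar variable can be read off from its identity block because its multiplicity is at least \<open>1\<close>.
  Outside the index ranges the functions \<open>q\<close> and \<open>D\<close> are \<open>undefined\<close> and hence agree.
\<close>

lemma inj_on_block_diag:
  assumes wf: "wf_blocks sb fb"
  shows "inj_on (block_diag sb fb) (space (block_params sb fb))"
proof (rule inj_onI)
  fix x y assume x: "x \<in> space (block_params sb fb)" and y: "y \<in> space (block_params sb fb)"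
    and eq: "block_diag sb fb x = block_diag sb fb y"
  obtain q D where qD: "x = (q, D)" by (cases x)
  obtain q' D' where qD': "y = (q', D')" by (cases y)
  have "block_list sb fb q D = block_list sb fb q' D'"
  proof (rule diag_block_mat_inj)
    show "map dim_row (block_list sb fb q D) = map dim_row (block_list sb fb q' D')"
      "map dim_col (block_list sb fb q D) = map dim_col (block_list sb fb q' D')"
      using block_params_full_block_dims[OF x[unfolded qD]]
        block_params_full_block_dims[OF y[unfolded qD']] by auto
    show "diag_block_mat (block_list sb fb q D) = diag_block_mat (block_list sb fb q' D')"
      using eq by (simp add: block_diag_def qD qD')
  qed
  then have blocks: "\<And>i. i < length sb \<Longrightarrow> q i \<cdot>\<^sub>m 1\<^sub>m (snd (sb ! i)) = q' i \<cdot>\<^sub>m 1\<^sub>m (snd (sb ! i))"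
    "\<And>j. j < length fb \<Longrightarrow> D j = D' j"
    by auto
  have "q i = q' i" if "i < length sb" for i
    using arg_cong[OF blocks(1)[OF that], of "\<lambda>A. A $$ (0, 0)"] wf_blocks_multiplicity[OF wf that]
    by simp
  then have "q = q'"
    using x y by (intro PiE_ext[of q "{..<length sb}" _ q']) (auto simp: qD qD' block_params_space)
  moreover have "D = D'"
    using x y blocks(2) by (intro PiE_ext[of D "{..<length fb}" _ D']) (auto simp: qD qD' block_params_space)
  ultimately show "x = y" by (simp add: qD qD')
qed

lemma block_vol_space: "space (block_vol sb fb) = block_set sb fb"
proof (rule Set.set_eqI, rule iffI)
  fix A assume "A \<in> space (block_vol sb fb)"
  then obtain q D where A: "A = block_diag sb fb (q, D)" and qD: "(q, D) \<in> space (block_params sb fb)"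
    unfolding block_vol_eq space_embed_measure by (metis imageE surj_pair)
  have "q i \<in> scalars (fst (sb ! i))" if "i < length sb" for i
    using qD that by (auto simp: block_params_space)
  moreover have "D j \<in> space (full_block_vol (fb ! j))" if "j < length fb" for j
    using qD that by (auto simp: block_params_space)
  ultimately show "A \<in> block_set sb fb"
    unfolding block_set_def A mem_Collect_eq full_block_vol_space
    by (intro exI[of _ q] exI[of _ D] conjI allI impI refl) (simp_all add: case_prod_beta)
next
  fix A assume "A \<in> block_set sb fb"
  then obtain q D where A: "A = block_diag sb fb (q, D)"
    and q: "\<And>i. i < length sb \<Longrightarrow> q i \<in> scalars (fst (sb ! i))"
    and D: "\<And>j. j < length fb \<Longrightarrow> case fb ! j of (F, n, m) \<Rightarrow>
        D j \<in> carrier_mat n m \<and> (\<forall>a<n. \<forall>b<m. D j $$ (a, b) \<in> scalars F)"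
    unfolding block_set_def by blast
  let ?q = "restrict q {..<length sb}" and ?D = "restrict D {..<length fb}"
  have "block_list sb fb ?q ?D = block_list sb fb q D" by simp
  then have "A = block_diag sb fb (?q, ?D)" by (simp only: A block_diag_def case_prod_conv)
  moreover have "D j \<in> space (full_block_vol (fb ! j))" if "j < length fb" for j
    using D[OF that] by (auto simp: full_block_vol_space split: prod.splits)
  then have "(?q, ?D) \<in> space (block_params sb fb)"
    using q by (auto simp: block_params_space)
  ultimately show "A \<in> space (block_vol sb fb)"
    unfolding block_vol_eq space_embed_measure by (rule image_eqI)
qed

lemma block_set_carrier: "A \<in> block_set sb fb \<Longrightarrow> A \<in> carrier_mat (block_rows sb fb) (block_cols sb fb)"
  unfolding block_vol_space[symmetric] block_vol_eq space_embed_measure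
  using block_diag_carrier by fastforce

lemma variable_dim_pos: "1 \<le> n \<Longrightarrow> 1 \<le> m \<Longrightarrow> 1 \<le> variable_dim F n m"
  by (cases F) auto

lemma
  assumes "wf_blocks sb fb"
  shows block_rows_pos: "1 \<le> block_rows sb fb" and block_cols_pos: "1 \<le> block_cols sb fb"
    and block_dim_pos: "1 \<le> block_dim sb fb"
proof -
  have "1 \<le> block_rows sb fb \<and> 1 \<le> block_cols sb fb \<and> 1 \<le> block_dim sb fb"
  proof (cases sb)
    case (Cons b sb')
    then have "1 \<le> snd b" using wf_blocks_multiplicity[OF assms, of 0] by simp
    moreover have "1 \<le> variable_dim (fst b) 1 1" by (intro variable_dim_pos) auto
    ultimately show ?thesis using Cons
      by (auto simp: block_rows_def block_cols_def block_dim_def upt_rec split: prod.splits)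
  next
    case Nil
    then obtain b fb' where fb: "fb = b # fb'" using assms by (cases fb) (auto simp: wf_blocks_def)
    then have "1 \<le> fst (snd b)" "1 \<le> snd (snd b)" using wf_blocks_size[OF assms, of 0] by auto
    moreover from this have "1 \<le> variable_dim (fst b) (fst (snd b)) (snd (snd b))"
      by (intro variable_dim_pos)
    ultimately show ?thesis using Nil fb
      by (auto simp: block_rows_def block_cols_def block_dim_def upt_rec split: prod.splits)
  qed
  then show "1 \<le> block_rows sb fb" "1 \<le> block_cols sb fb" "1 \<le> block_dim sb fb" by auto
qed

lemma block_dim_eq_sum:
  "block_dim sb fb = (\<Sum>i<length sb. variable_dim (fst (sb ! i)) 1 1) +
     (\<Sum>j<length fb. variable_dim (fst (fb ! j)) (fst (snd (fb ! j))) (snd (snd (fb ! j))))"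
  by (simp add: block_dim_def sum_list_sum_nth atLeast0LessThan case_prod_beta)

lemma scaling_volume_block_vol:
  assumes wf: "wf_blocks sb fb"
  shows "scaling_volume (block_vol sb fb) (\<lambda>t A. of_real t \<cdot>\<^sub>m A)
    (\<lambda>e. block_diag sb fb ` block_box sb fb e) (block_dim sb fb)"
proof -
  have "scaling_volume (full_block_vol b) (\<lambda>t A. of_real t \<cdot>\<^sub>m A)
      (case b of (F, n, m) \<Rightarrow> matrix_box F n m)
      (variable_dim (fst b) (fst (snd b)) (snd (snd b)))" for b
    by (cases b) (simp add: full_block_vol_def scaling_volume_matrix_vol)
  then have "scaling_volume (block_params sb fb)
      (\<lambda>t (q, D). (\<lambda>i\<in>{..<length sb}. of_real t * q i, \<lambda>j\<in>{..<length fb}. of_real t \<cdot>\<^sub>m D j))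
      (\<lambda>e. (\<Pi>\<^sub>E i\<in>{..<length sb}. scalar_disc (fst (sb ! i)) e) \<times>
        (\<Pi>\<^sub>E j\<in>{..<length fb}. (case fb ! j of (F, n, m) \<Rightarrow> matrix_box F n m) e))
      (block_dim sb fb)"
    unfolding block_params_def block_dim_eq_sum
    by (intro scaling_volume_pair_measure scaling_volume_PiM scaling_volume_scalar_vol) auto
  moreover have "(case fb ! j of (F, n, m) \<Rightarrow> matrix_box F n m) e =
      (case fb ! j of (F, n, m) \<Rightarrow> matrix_box F n m e)" for j e
    by (simp add: case_prod_beta)
  ultimately have "scaling_volume (block_params sb fb)
      (\<lambda>t (q, D). (\<lambda>i\<in>{..<length sb}. of_real t * q i, \<lambda>j\<in>{..<length fb}. of_real t \<cdot>\<^sub>m D j))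
      (block_box sb fb) (block_dim sb fb)"
    by (simp add: block_box_def[abs_def])
  then show ?thesis
    unfolding block_vol_eq
  proof (rule scaling_volume_embed_measure[OF _ inj_on_block_diag[OF wf]])
    fix t :: real and x assume "x \<in> space (block_params sb fb)"
    obtain q D where x: "x = (q, D)" by (cases x)
    have "map (\<lambda>A. of_real t \<cdot>\<^sub>m A) (block_list sb fb q D) =
      block_list sb fb (\<lambda>i\<in>{..<length sb}. of_real t * q i) (\<lambda>j\<in>{..<length fb}. of_real t \<cdot>\<^sub>m D j)"
      by (auto intro!: eq_matI)
    then show "of_real t \<cdot>\<^sub>m block_diag sb fb x = block_diag sb fb
        (case x of (q, D) \<Rightarrow> (\<lambda>i\<in>{..<length sb}. of_real t * q i, \<lambda>j\<in>{..<length fb}. of_real t \<cdot>\<^sub>m D j))"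
      by (simp only: x block_diag_def case_prod_conv smult_diag_block_mat)
  qed
qed

lemma measurable_mat_block_vol:
  "measurable_mat (block_vol sb fb) (block_rows sb fb) (block_cols sb fb) (\<lambda>A. A)"
proof -
  let ?M = "block_params sb fb"
  define ks :: "(nat + nat) list" where "ks = map Inl [0..<length sb] @ map Inr [0..<length fb]"
  define nr nc where "nr = case_sum (\<lambda>i. snd (sb ! i)) (\<lambda>j. fst (snd (fb ! j)))"
    and "nc = case_sum (\<lambda>i. snd (sb ! i)) (\<lambda>j. snd (snd (fb ! j)))"
  define f :: "nat + nat \<Rightarrow> (nat \<Rightarrow> complex) \<times> (nat \<Rightarrow> complex mat) \<Rightarrow> complex mat"
    where "f = case_sum (\<lambda>i p. fst p i \<cdot>\<^sub>m 1\<^sub>m (snd (sb ! i))) (\<lambda>j p. snd p j)"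
  have block: "measurable_mat ?M (nr k) (nc k) (f k)" if "k \<in> set ks" for k
  proof (cases k)
    case (Inl i)
    then have i: "i < length sb" using that by (auto simp: ks_def)
    have "(\<lambda>q. q i) \<in> measurable (\<Pi>\<^sub>M i\<in>{..<length sb}. scalar_vol (fst (sb ! i))) (scalar_vol (fst (sb ! i)))"
      using i by (intro measurable_component_singleton) auto
    then have "(\<lambda>q. q i) \<in> borel_measurable (\<Pi>\<^sub>M i\<in>{..<length sb}. scalar_vol (fst (sb ! i)))"
      using measurable_scalar_vol_borel by (rule measurable_compose)
    then have q: "(\<lambda>p. fst p i) \<in> borel_measurable ?M"
      unfolding block_params_def by (rule measurable_compose[OF measurable_fst])
    have "(\<lambda>p. (fst p i \<cdot>\<^sub>m 1\<^sub>m n) $$ (a, b)) \<in> borel_measurable ?M" if "a < n" "b < n" for a b n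
      using q that by (cases "a = b") auto
    then show ?thesis by (simp add: measurable_mat_def Inl nr_def nc_def f_def)
  next
    case (Inr j)
    then have j: "j < length fb" using that by (auto simp: ks_def)
    have comp: "(\<lambda>p. snd p j) \<in> measurable ?M (full_block_vol (fb ! j))"
      unfolding block_params_def using j
      by (intro measurable_compose[OF measurable_snd measurable_component_singleton]) auto
    have "(\<lambda>A. A $$ (a, b)) \<in> borel_measurable (full_block_vol (fb ! j))"
      if "a < fst (snd (fb ! j))" "b < snd (snd (fb ! j))" for a b
      using measurable_entry_matrix_vol[OF that] by (simp add: full_block_vol_def case_prod_beta)
    then have "(\<lambda>p. snd p j $$ (a, b)) \<in> borel_measurable ?M"
      if "a < fst (snd (fb ! j))" "b < snd (snd (fb ! j))" for a b
      using that by (intro measurable_compose[OF comp]) auto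
    moreover have "snd p j \<in> carrier_mat (fst (snd (fb ! j))) (snd (snd (fb ! j)))" if "p \<in> space ?M" for p
      using that j block_params_full_block_carrier[of "fst p" "snd p"] by simp
    ultimately show ?thesis by (simp add: measurable_mat_def Inr nr_def nc_def f_def)
  qed
  have "(\<Sum>k\<leftarrow>ks. nr k) = block_rows sb fb" "(\<Sum>k\<leftarrow>ks. nc k) = block_cols sb fb"
    by (simp_all add: ks_def nr_def nc_def block_rows_def block_cols_def comp_def)
  moreover have "diag_block_mat (map (\<lambda>k. f k p) ks) = block_diag sb fb p" for p
    by (simp add: ks_def f_def block_diag_def comp_def case_prod_beta)
  ultimately have "measurable_mat ?M (block_rows sb fb) (block_cols sb fb) (block_diag sb fb)"
    using measurable_mat_diag_block_mat[of ks ?M nr nc f, OF block] by simp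
  then show ?thesis
    unfolding measurable_mat_def block_vol_eq
    by (auto simp: space_embed_measure intro: measurable_embed_measure1)
qed

section \<open>Spectral norm balls\<close>

lemma block_diag_contains_parameters:
  assumes "(q, D) \<in> space (block_params sb fb)"
  defines "A \<equiv> block_diag sb fb (q, D)"
  shows "i < length sb \<Longrightarrow> 1 \<le> snd (sb ! i) \<Longrightarrow>
      \<exists>a<block_rows sb fb. \<exists>b<block_cols sb fb. A $$ (a, b) = q i"
    and "j < length fb \<Longrightarrow> x < fst (snd (fb ! j)) \<Longrightarrow> y < snd (snd (fb ! j)) \<Longrightarrow>
      \<exists>a<block_rows sb fb. \<exists>b<block_cols sb fb. A $$ (a, b) = D j $$ (x, y)"
proof -
  have dims: "dim_row A = block_rows sb fb" "dim_col A = block_cols sb fb"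
    using block_diag_carrier[OF assms(1)] by (auto simp: A_def)
  have A: "A = diag_block_mat (block_list sb fb q D)" by (simp add: A_def block_diag_def)
  note entry = diag_block_mat_contains_entry[where Ds = "block_list sb fb q D", folded A, unfolded dims]
  show "\<exists>a<block_rows sb fb. \<exists>b<block_cols sb fb. A $$ (a, b) = q i"
    if "i < length sb" "1 \<le> snd (sb ! i)"
    using entry[of "q i \<cdot>\<^sub>m 1\<^sub>m (snd (sb ! i))" 0 0] that by auto
  show "\<exists>a<block_rows sb fb. \<exists>b<block_cols sb fb. A $$ (a, b) = D j $$ (x, y)"
    if "j < length fb" "x < fst (snd (fb ! j))" "y < snd (snd (fb ! j))"
    using entry[of "D j" x y] that block_params_full_block_carrier[OF assms(1) that(1)] by auto
qed

text \<open>
  Every entry of a variable occurs as an entry of the block-diagonal matrix, so a bound on the matrix is a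
  bound on the variables. Together with the next lemma, the boxes of variables are exactly the bounded
  parts of the space of block-diagonal matrices.
\<close>

lemma bounded_entries_subset_block_box:
  assumes wf: "wf_blocks sb fb" and A: "A \<in> block_set sb fb"
    and le: "\<And>a b. a < block_rows sb fb \<Longrightarrow> b < block_cols sb fb \<Longrightarrow> cmod (A $$ (a, b)) \<le> e"
  shows "A \<in> block_diag sb fb ` block_box sb fb e"
proof -
  obtain q D where A: "A = block_diag sb fb (q, D)" and qD: "(q, D) \<in> space (block_params sb fb)"
    using A unfolding block_vol_space[symmetric] block_vol_eq space_embed_measure by (metis imageE surj_pair)
  note qD' = qD[unfolded block_params_space mem_Times_iff fst_conv snd_conv]
  have "q i \<in> scalar_disc (fst (sb ! i)) e" if i: "i < length sb" for i
  proof -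
    have "cmod (q i) \<le> e"
      using block_diag_contains_parameters(1)[OF qD i wf_blocks_multiplicity[OF wf i]] le A by metis
    then show ?thesis using qD' i by (auto simp: scalar_disc_def)
  qed
  moreover have "D j \<in> matrix_box (fst (fb ! j)) (fst (snd (fb ! j))) (snd (snd (fb ! j))) e"
    if j: "j < length fb" for j
  proof -
    have "cmod (D j $$ (x, y)) \<le> e" if "x < fst (snd (fb ! j))" "y < snd (snd (fb ! j))" for x y
      using block_diag_contains_parameters(2)[OF qD j that] le A by metis
    moreover have "D j \<in> space (full_block_vol (fb ! j))" using qD' j by auto
    ultimately show ?thesis by (auto simp: matrix_box_eq full_block_vol_space)
  qed
  ultimately have "(q, D) \<in> block_box sb fb e"
    using qD' by (auto simp: block_box_def case_prod_beta PiE_iff)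
  then show ?thesis unfolding A by (rule imageI)
qed

lemma block_box_bounded_entries:
  assumes A: "A \<in> block_diag sb fb ` block_box sb fb e" and e: "0 \<le> e"
    and ab: "a < dim_row A" "b < dim_col A"
  shows "cmod (A $$ (a, b)) \<le> e"
proof -
  obtain q D where A: "A = block_diag sb fb (q, D)"
    and q: "\<And>i. i < length sb \<Longrightarrow> q i \<in> scalar_disc (fst (sb ! i)) e"
    and D: "\<And>j. j < length fb \<Longrightarrow> D j \<in> matrix_box (fst (fb ! j)) (fst (snd (fb ! j))) (snd (snd (fb ! j))) e"
    using A by (auto simp: block_box_def case_prod_beta PiE_iff)
  have "A $$ (a, b) \<in> elements_mat A" using ab by (intro elements_matI[of A]) auto
  then have "A $$ (a, b) \<in> {0} \<union> \<Union> (set (map elements_mat (block_list sb fb q D)))"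
    using elements_diag_block_mat[of "block_list sb fb q D"] by (auto simp: A block_diag_def)
  then consider "A $$ (a, b) = 0"
    | i where "i < length sb" "A $$ (a, b) \<in> elements_mat (q i \<cdot>\<^sub>m 1\<^sub>m (snd (sb ! i)))"
    | j where "j < length fb" "A $$ (a, b) \<in> elements_mat (D j)"
    by auto
  then show ?thesis
  proof cases
    case 1
    then show ?thesis using e by simp
  next
    case (2 i)
    then have "A $$ (a, b) = 0 \<or> A $$ (a, b) = q i"
      by (auto dest!: elements_matD)
    then show ?thesis using q[OF 2(1)] e by (auto simp: scalar_disc_def)
  next
    case (3 j)
    then show ?thesis using D[OF 3(1)] by (auto simp: matrix_box_eq dest!: elements_matD)
  qed
qed

lemma block_box_subset_block_set:
  assumes "wf_blocks sb fb" "0 < e"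
  shows "block_diag sb fb ` block_box sb fb e \<subseteq> block_set sb fb"
  using sets.sets_into_space[OF scaling_volumeD(4)[OF scaling_volume_block_vol[OF assms(1)] assms(2)]]
  by (simp add: block_vol_space)

lemma zero_mem_block_set: "0\<^sub>m (block_rows sb fb) (block_cols sb fb) \<in> block_set sb fb"
proof -
  define q :: "nat \<Rightarrow> complex" where "q = (\<lambda>i\<in>{..<length sb}. 0)"
  define D :: "nat \<Rightarrow> complex mat"
    where "D = (\<lambda>j\<in>{..<length fb}. 0\<^sub>m (fst (snd (fb ! j))) (snd (snd (fb ! j))))"
  have "0 \<in> scalars F" for F by (cases F) auto
  then have qD: "(q, D) \<in> space (block_params sb fb)"
    by (auto simp: block_params_space full_block_vol_space q_def D_def)
  have box: "block_diag sb fb (q, D) \<in> block_diag sb fb ` block_box sb fb 0"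
    using \<open>\<And>F. 0 \<in> scalars F\<close>
    by (auto simp: block_box_def case_prod_beta matrix_box_eq scalar_disc_def q_def D_def)
  have "block_diag sb fb (q, D) = 0\<^sub>m (block_rows sb fb) (block_cols sb fb)"
    using block_diag_carrier[OF qD] block_box_bounded_entries[OF box] by (intro eq_matI) auto
  then show ?thesis
    using qD unfolding block_vol_space[symmetric] block_vol_eq space_embed_measure by (metis image_eqI)
qed

lemma smult_block_set:
  assumes "wf_blocks sb fb" "0 < t" "A \<in> block_set sb fb"
  shows "of_real t \<cdot>\<^sub>m A \<in> block_set sb fb"
  using measurable_space[OF scaling_volumeD(2)[OF scaling_volume_block_vol[OF assms(1)] assms(2)]] assms(3)
  by (simp add: block_vol_space)

lemma smult_mem_spectral_ball_iff:
  assumes wf: "wf_blocks sb fb" and t: "0 < t" and \<rho>: "0 \<le> \<rho>" and A: "A \<in> block_set sb fb"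
  shows "of_real t \<cdot>\<^sub>m A \<in> spectral_ball sb fb (t * \<rho>) \<longleftrightarrow> A \<in> spectral_ball sb fb \<rho>"
proof -
  note carrier = block_set_carrier[OF A] and cols = block_cols_pos[OF wf]
  have tA: "of_real t \<cdot>\<^sub>m A \<in> block_set sb fb" using smult_block_set[OF wf t A] .
  have "largest_singular_value A \<le> \<rho>" if "largest_singular_value (of_real t \<cdot>\<^sub>m A) \<le> t * \<rho>"
  proof -
    have "largest_singular_value (of_real (1 / t) \<cdot>\<^sub>m (of_real t \<cdot>\<^sub>m A)) \<le> 1 / t * (t * \<rho>)"
      using t \<rho> that by (intro largest_singular_value_smult_le[OF block_set_carrier[OF tA] cols]) auto
    moreover have "of_real (1 / t) \<cdot>\<^sub>m (of_real t \<cdot>\<^sub>m A) = A" using t by (intro eq_matI) auto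
    ultimately show ?thesis using t by simp
  qed
  then show ?thesis
    using A tA largest_singular_value_smult_le[OF carrier cols t \<rho>] by (auto simp: spectral_ball_def)
qed

lemma sets_spectral_ball:
  assumes "wf_blocks sb fb" "0 \<le> \<rho>"
  shows "spectral_ball sb fb \<rho> \<in> sets (block_vol sb fb)"
proof -
  have "Measurable.pred (block_vol sb fb) (\<lambda>A. largest_singular_value A \<le> \<rho>)"
    using pred_largest_singular_value_le[OF measurable_mat_block_vol block_cols_pos] assms by blast
  then show ?thesis
    by (simp add: pred_def spectral_ball_def block_vol_space)
qed

text \<open>
  With \<open>m\<close> columns and \<open>n\<close> rows, entries of modulus at most \<open>1 / (m n)\<close> force the Frobenius norm, and
  with it the spectral norm, to be at most \<open>1\<close>. Conversely, in the unit ball the squared Frobenius norm is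
  at most \<open>m\<close>, so the entries have modulus at most \<open>m\<close>.
\<close>

lemma emeasure_unit_spectral_ball:
  assumes wf: "wf_blocks sb fb"
  shows "0 < emeasure (block_vol sb fb) (spectral_ball sb fb 1)"
    "emeasure (block_vol sb fb) (spectral_ball sb fb 1) < \<infinity>"
proof -
  note vol = scaling_volumeD[OF scaling_volume_block_vol[OF wf]]
  let ?r = "block_rows sb fb" and ?c = "block_cols sb fb"
  note r = block_rows_pos[OF wf] and c = block_cols_pos[OF wf]
  define e where "e = 1 / real (?c * ?r)"
  have cr: "1 \<le> real (?c * ?r)" using r c by (metis mult_le_mono nat_mult_1 of_nat_1 of_nat_le_iff)
  then have e: "0 < e" by (simp add: e_def)
  have "block_diag sb fb ` block_box sb fb e \<subseteq> spectral_ball sb fb 1"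
  proof
    fix A assume A: "A \<in> block_diag sb fb ` block_box sb fb e"
    then have A': "A \<in> block_set sb fb" using block_box_subset_block_set[OF wf e] by blast
    note carrier = block_set_carrier[OF A']
    have "frobenius_square A \<le> real (?c * ?r) * e\<^sup>2"
      using carrier e by (intro frobenius_square_le[OF carrier] block_box_bounded_entries[OF A]) auto
    also have "\<dots> = 1 / real (?c * ?r)" using cr by (simp add: e_def power2_eq_square)
    also have "\<dots> \<le> 1\<^sup>2" using cr by simp
    finally show "A \<in> spectral_ball sb fb 1"
      using A' largest_singular_value_le_frobenius[OF carrier c, of 1] by (simp add: spectral_ball_def)
  qed
  then have "emeasure (block_vol sb fb) (block_diag sb fb ` block_box sb fb e) \<le>
      emeasure (block_vol sb fb) (spectral_ball sb fb 1)"
    using sets_spectral_ball[OF wf] by (intro emeasure_mono) auto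
  then show "0 < emeasure (block_vol sb fb) (spectral_ball sb fb 1)"
    using vol(5)[OF e] by (rule order.strict_trans2[rotated])
  have "spectral_ball sb fb 1 \<subseteq> block_diag sb fb ` block_box sb fb (real ?c)"
  proof
    fix A assume "A \<in> spectral_ball sb fb 1"
    then have A: "A \<in> block_set sb fb" and sv: "largest_singular_value A \<le> 1"
      by (auto simp: spectral_ball_def)
    note carrier = block_set_carrier[OF A]
    have "cmod (A $$ (a, b)) \<le> real ?c" if "a < ?r" "b < ?c" for a b
    proof -
      have "(cmod (A $$ (a, b)))\<^sup>2 \<le> real ?c * 1\<^sup>2"
        using cmod_entry_le_frobenius[OF carrier that]
          frobenius_square_le_largest_singular_value[OF carrier c _ sv] by simp
      also have "\<dots> \<le> (real ?c)\<^sup>2" using c by (simp add: power2_eq_square)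
      finally show ?thesis by (rule power2_le_imp_le) simp
    qed
    then show "A \<in> block_diag sb fb ` block_box sb fb (real ?c)"
      by (rule bounded_entries_subset_block_box[OF wf A])
  qed
  then have "emeasure (block_vol sb fb) (spectral_ball sb fb 1) \<le>
      emeasure (block_vol sb fb) (block_diag sb fb ` block_box sb fb (real ?c))"
    using vol(4)[of "real ?c"] c by (intro emeasure_mono) auto
  then show "emeasure (block_vol sb fb) (spectral_ball sb fb 1) < \<infinity>"
    using vol(6)[of "real ?c"] c by (auto intro: order.strict_trans1)
qed

lemma spectral_ball_0:
  assumes wf: "wf_blocks sb fb"
  shows "spectral_ball sb fb 0 = {0\<^sub>m (block_rows sb fb) (block_cols sb fb)}"
proof (intro equalityI subsetI)
  fix A assume "A \<in> spectral_ball sb fb 0"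
  then have A: "A \<in> block_set sb fb" and sv: "largest_singular_value A \<le> 0"
    by (auto simp: spectral_ball_def)
  note carrier = block_set_carrier[OF A]
  have "A $$ (a, b) = 0" if "a < block_rows sb fb" "b < block_cols sb fb" for a b
  proof -
    have "frobenius_square A \<le> 0"
      using frobenius_square_le_largest_singular_value[OF carrier block_cols_pos[OF wf] _ sv] by simp
    with cmod_entry_le_frobenius[OF carrier that] have "(cmod (A $$ (a, b)))\<^sup>2 \<le> 0"
      by (rule order_trans)
    then show ?thesis by simp
  qed
  then show "A \<in> {0\<^sub>m (block_rows sb fb) (block_cols sb fb)}"
    using carrier by (auto intro!: eq_matI)
next
  fix A assume "A \<in> {0\<^sub>m (block_rows sb fb) (block_cols sb fb) :: complex mat}"
  then have A: "A = 0\<^sub>m (block_rows sb fb) (block_cols sb fb)" by simp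
  then have carrier: "A \<in> carrier_mat (block_rows sb fb) (block_cols sb fb)" by simp
  have "frobenius_square A = 0" by (simp add: A frobenius_square_def)
  then have "largest_singular_value A \<le> 0"
    using largest_singular_value_le_frobenius[OF carrier block_cols_pos[OF wf], of 0] by simp
  then show "A \<in> spectral_ball sb fb 0"
    using zero_mem_block_set by (simp add: A spectral_ball_def)
qed

lemma scaling_family_spectral_ball:
  assumes wf: "wf_blocks sb fb"
  shows "scaling_family (block_vol sb fb) (spectral_ball sb fb) (block_dim sb fb)
    (measure (block_vol sb fb) (spectral_ball sb fb 1))"
proof
  let ?V = "block_vol sb fb" and ?B = "spectral_ball sb fb"
  note vol = scaling_volumeD[OF scaling_volume_block_vol[OF wf]]
  have unit: "emeasure ?V (?B 1) = ennreal (measure ?V (?B 1))"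
    using emeasure_unit_spectral_ball(2)[OF wf] by (intro emeasure_eq_ennreal_measure) auto
  show "1 \<le> block_dim sb fb" using wf by (rule block_dim_pos)
  show "0 < measure ?V (?B 1)"
    using emeasure_unit_spectral_ball(1)[OF wf] unit by (metis ennreal_less_zero_iff)
  show "?B \<rho> \<in> sets ?V" if "0 \<le> \<rho>" for \<rho>
    using wf that by (rule sets_spectral_ball)
  show "emeasure ?V (?B \<rho>) = ennreal (\<rho> ^ block_dim sb fb * measure ?V (?B 1))" if \<rho>: "0 < \<rho>" for \<rho>
  proof -
    have "(\<lambda>A. of_real \<rho> \<cdot>\<^sub>m A) -` ?B \<rho> \<inter> space ?V = ?B 1"
      using smult_mem_spectral_ball_iff[OF wf \<rho>, of 1]
      by (auto simp: block_vol_space spectral_ball_def)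
    then show ?thesis
      using vol(3)[OF \<rho> sets_spectral_ball[OF wf], of \<rho>] \<rho> unit by (simp add: ennreal_mult)
  qed
  show "?B \<rho> \<subseteq> ?B \<rho>'" if "\<rho> \<le> \<rho>'" for \<rho> \<rho>'
    using that by (auto simp: spectral_ball_def)
  show "\<exists>m\<ge>0. \<forall>\<sigma>\<ge>0. A \<in> ?B \<sigma> \<longleftrightarrow> m \<le> \<sigma>" if "A \<in> ?B \<rho>" for A \<rho>
    using that largest_singular_value_nonneg[OF block_set_carrier block_cols_pos[OF wf]]
    by (intro exI[of _ "largest_singular_value A"]) (auto simp: spectral_ball_def)
  show "\<exists>c. ?B 0 = {c}" using spectral_ball_0[OF wf] by blast
qed

section \<open>The sample reuse factor\<close>

theorem theorem1:
  fixes N l :: nat and r :: "nat \<Rightarrow> real" and M :: "'w measure"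
  assumes "1 \<le> N" and "1 \<le> l"
    and "\<forall>i\<in>{1..<l}. r (i + 1) < r i" and "0 \<le> r l"
  shows
    "(\<forall>(p::enat) (P :: real ^ 'n \<Rightarrow> bool) X.
        1 \<le> p \<longrightarrow> uniform_samples M lborel (lp_ball p) l r X \<longrightarrow>
        reuse_factor M (lp_ball p) N l r P X =
          real l / (real l - (\<Sum>i=2..l. (r i / r (i - 1)) ^ CARD('n)))) \<and>
     (\<forall>(Q :: (real ^ 'n) set) c (P :: real ^ 'n \<Rightarrow> bool) X.
        compact Q \<longrightarrow> 0 < measure lborel Q \<longrightarrow> c \<in> Q \<longrightarrow> star_shaped_wrt Q c \<longrightarrow>
        uniform_samples M lborel (homogeneous_family Q c) l r X \<longrightarrow>
        reuse_factor M (homogeneous_family Q c) N l r P X =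
          real l / (real l - (\<Sum>i=2..l. (r i / r (i - 1)) ^ CARD('n)))) \<and>
     (\<forall>sb fb (P :: complex mat \<Rightarrow> bool) X.
        wf_blocks sb fb \<longrightarrow>
        uniform_samples M (block_vol sb fb) (spectral_ball sb fb) l r X \<longrightarrow>
        reuse_factor M (spectral_ball sb fb) N l r P X =
          real l / (real l - (\<Sum>i=2..l. (r i / r (i - 1)) ^ block_dim sb fb)))"
proof (intro conjI allI impI)
  note run = sample_reuse_run.reuse_factor_eq[OF
      sample_reuse_run.intro[OF _ sample_reuse_run_axioms.intro[OF assms]]]
  show "reuse_factor M (lp_ball p) N l r P X =
      real l / (real l - (\<Sum>i=2..l. (r i / r (i - 1)) ^ CARD('n)))"
    if "1 \<le> p" "uniform_samples M lborel (lp_ball p) l r X"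
    for p and P :: "real ^ 'n \<Rightarrow> bool" and X
    using run[OF scaling_family_lp_ball[OF that(1)] that(2)] .
  show "reuse_factor M (homogeneous_family Q c) N l r P X =
      real l / (real l - (\<Sum>i=2..l. (r i / r (i - 1)) ^ CARD('n)))"
    if "compact Q" "0 < measure lborel Q" "c \<in> Q" "star_shaped_wrt Q c"
      "uniform_samples M lborel (homogeneous_family Q c) l r X"
    for Q c and P :: "real ^ 'n \<Rightarrow> bool" and X
    using run[OF scaling_family_homogeneous_family[OF that(1-4)] that(5)] by simp
  show "reuse_factor M (spectral_ball sb fb) N l r P X =
      real l / (real l - (\<Sum>i=2..l. (r i / r (i - 1)) ^ block_dim sb fb))"
    if "wf_blocks sb fb" "uniform_samples M (block_vol sb fb) (spectral_ball sb fb) l r X"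
    for sb fb and P :: "complex mat \<Rightarrow> bool" and X
    using run[OF scaling_family_spectral_ball[OF that(1)] that(2)] .
qed

end
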